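(* Let $E$ be a nonzero real Banach space, let $f, g : E \times E^* \to\, ]-\infty,\infty]$ be proper, convex and lower semicontinuous, with $f \ge q_L$ and $g \ge q_L$ on $E \times E^*$. Suppose that $$\bigcup_{\lambda > 0}\lambda\big[\pi_1\,\mathrm{dom}\,f - \pi_1\,\mathrm{dom}\,g\big] \text{ is a closed subspace of } E,$$ and that $\mathrm{coinc}[f]$ and $\mathrm{coinc}[g]$ are quasidense in $E \times E^*$. Then $(f \oplus_2 g)^@ \ge q_L$ on $E \times E^*$, the set $\mathrm{coinc}[(f \oplus_2 g)^@]$ is closed and quasidense in $E \times E^*$, and, for all $(y,y^* ) \in E \times E^*$: $(y,y^* ) \in \mathrm{coinc}[(f \oplus_2 g)^@]$ if and only if there exist $u^*, v^* \in E^*$ such that $(y,u^* ) \in \mathrm{coinc}[f^@]$, $(y,v^* ) \in \mathrm{coinc}[g^@]$ and $u^* + v^* = y^*$.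
   Context: $q_L(x,x^* ) := \langle x, x^*\rangle$ on $E \times E^*$, and $\mathrm{coinc}[k] := \{b \in E \times E^* : k(b) = q_L(b)\}$ for a function $k \ge q_L$ on $E \times E^*$. $\mathrm{dom}\,k$ is the set where $k$ is finite; $k$ is proper if $\mathrm{dom}\,k \neq \emptyset$. $\pi_1(x,x^* ) := x$. The partial episum is $(f \oplus_2 g)(x,x^* ) := \inf_{\xi^* \in E^*}[f(x, x^* - \xi^* ) + g(x,\xi^* )]$. For a proper convex function $k$ on $E \times E^*$, the function $k^@$ on $E \times E^*$ is $k^@(x,x^* ) := \sup_{(s,s^* ) \in E \times E^*}[\langle s, x^*\rangle + \langle x, s^*\rangle - k(s,s^* )]$. $E \times E^*$ is normed by $\|(x,x^* )\| := \sqrt{\|x\|^2 + \|x^*\|^2}$. A subset $A \subset E \times E^*$ is quasidense (in $E \times E^*$) if, for all $(x,x^* ) \in E \times E^*$, $\inf_{(s,s^* ) \in A}\big[\frac12\|s-x\|^2 + \frac12\|s^*-x^*\|^2 + \langle s-x, s^*-x^*\rangle\big] \le 0$. *)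

theory Defs
  imports "HOL-Analysis.Analysis"
begin

text \<open>
  The dual \<open>E\<^sup>*\<close> of a real normed space is the type of bounded linear functionals with the operator
  norm. The library's norm on a product type is \<open>sqrt ((norm x)\<^sup>2 + (norm x')\<^sup>2)\<close>, which is the norm
  used on \<open>E \<times> E\<^sup>*\<close> here; in particular \<open>closed\<close> on \<open>E \<times> E\<^sup>*\<close> refers to the norm topology.
\<close>

type_synonym 'a dual = "'a \<Rightarrow>\<^sub>L real"

definition q_L :: "'a::real_normed_vector \<times> 'a dual \<Rightarrow> real" where
  "q_L = (\<lambda>(x, x'). blinfun_apply x' x)"

definition edom :: "('b \<Rightarrow> ereal) \<Rightarrow> 'b set" where
  "edom k = {b. \<bar>k b\<bar> \<noteq> \<infinity>}"

definition proper_fun :: "('b \<Rightarrow> ereal) \<Rightarrow> bool" where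
  "proper_fun k \<longleftrightarrow> edom k \<noteq> {}"

text \<open>
  The library's \<open>convex_on\<close> requires values in a real vector space, which excludes \<open>ereal\<close>.
  This definition is meant for functions that avoid \<open>-\<infinity>\<close>, where the right-hand side is unambiguous.
\<close>

definition convex_fun :: "('b::real_vector \<Rightarrow> ereal) \<Rightarrow> bool" where
  "convex_fun k \<longleftrightarrow>
     (\<forall>a b t. 0 < t \<and> t < 1 \<longrightarrow>
        k ((1 - t) *\<^sub>R a + t *\<^sub>R b) \<le> ereal (1 - t) * k a + ereal t * k b)"

definition lower_semicontinuous :: "('b::topological_space \<Rightarrow> ereal) \<Rightarrow> bool" where
  "lower_semicontinuous k \<longleftrightarrow> (\<forall>b c. c < k b \<longrightarrow> (\<forall>\<^sub>F a in nhds b. c < k a))"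

definition coinc :: "('a::real_normed_vector \<times> 'a dual \<Rightarrow> ereal) \<Rightarrow> ('a \<times> 'a dual) set" where
  "coinc k = {b. k b = ereal (q_L b)}"

definition partial_episum ::
    "('a::real_normed_vector \<times> 'a dual \<Rightarrow> ereal) \<Rightarrow> ('a \<times> 'a dual \<Rightarrow> ereal)
       \<Rightarrow> ('a \<times> 'a dual \<Rightarrow> ereal)"  (infixl \<open>\<oplus>\<^sub>2\<close> 65) where
  "f \<oplus>\<^sub>2 g = (\<lambda>(x, x'). INF \<xi>. f (x, x' - \<xi>) + g (x, \<xi>))"

text \<open>
  This is \<open>k\<^sup>@\<close>, the Fenchel conjugate of \<open>k\<close> under the pairing of \<open>E \<times> E\<^sup>*\<close> with itself given by
  \<open>((s, s'), (x, x')) \<mapsto> x' s + s' x\<close>.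
\<close>

definition at_conjugate ::
    "('a::real_normed_vector \<times> 'a dual \<Rightarrow> ereal) \<Rightarrow> ('a \<times> 'a dual \<Rightarrow> ereal)" where
  "at_conjugate k = (\<lambda>(x, x').
     SUP (s, s')\<in>UNIV. ereal (blinfun_apply x' s + blinfun_apply s' x) - k (s, s'))"

text \<open>
  The infimum is taken in \<open>ereal\<close>, so that it is \<open>\<infinity>\<close> over the empty set: the empty set is not
  quasidense.
\<close>

definition quasidense :: "('a::real_normed_vector \<times> 'a dual) set \<Rightarrow> bool" where
  "quasidense A \<longleftrightarrow>
     (\<forall>x x'. (INF (s, s')\<in>A.
        ereal ((norm (s - x))\<^sup>2 / 2 + (norm (s' - x'))\<^sup>2 / 2 + blinfun_apply (s' - x') (s - x))) \<le> 0)"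

end

theory Submission
  imports Defs
begin

text \<open>
  Write \<open>E\<close> for the underlying Banach space and \<open>q\<close> for \<^const>\<open>q_L\<close>. Functions with values in \<open>ereal\<close> are
  replaced by sets of pairs \<open>(b, r)\<close> over which they are infima of \<open>r\<close>, usually their epigraphs, so that convexity,
  lower semicontinuity and \<open>k \<ge> q\<close> become statements about a subset of \<open>(E \<times> E\<^sup>*) \<times> \<real>\<close>.

  That \<open>k\<^sup>@ \<ge> q\<close> and that \<open>k\<^sup>@\<close> has a closed quasidense coincidence set follow from one property of a convex
  function \<open>k \<ge> q\<close>: for every
  centre \<open>c\<close> the nonnegative quantity \<open>k b - q b + \<parallel>b - c\<parallel>\<^sup>2 / 2 + q (b - c)\<close> has infimum \<open>0\<close> over \<open>b\<close>. If this holds,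
  an approximate minimizer can be improved repeatedly, each time with its predecessor as the new centre.
  Convexity and \<open>k \<ge> q\<close> bound \<open>- q (b - b')\<close> by the gaps \<open>k - q\<close> at \<open>b\<close> and \<open>b'\<close>, so the improvements form a Cauchy
  sequence; at its limit the lower semicontinuous hull of \<open>k\<close> equals \<open>q\<close>, and so does \<open>k\<^sup>@\<close>, because the hull minus
  \<open>q\<close> has a minimum there. This is \<open>coinc_conjugate_of_nearly_touching\<close>.

  It remains to verify the property for \<open>k = f \<oplus>\<^sub>2 g\<close>. By Fenchel duality its failure at \<open>c\<close> would give a
  functional on \<open>E \<times> E\<^sup>*\<close> at which the full conjugate of \<open>k\<close> lies strictly below the pairing of \<open>E\<^sup>*\<close> with the
  bidual. That pairing is a lower bound for the full conjugates of \<open>f\<close> and \<open>g\<close>, since their coincidence sets are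
  quasidense (\<open>quasidense_conjugate_above_bidual_q\<close>), and the bounds add up when the functional on \<open>E\<close> is
  split suitably between \<open>f\<close> and \<open>g\<close>. The splitting and the duality both come from one application
  of a multiplier theorem (\<open>Lagrange_multiplier\<close>) for a linear objective on a closed convex set. Its
  hypothesis reduces to the closed subspace condition on \<open>\<Union>\<lambda>. \<lambda> (\<pi>\<^sub>1 dom f - \<pi>\<^sub>1 dom g)\<close>; the proof combines
  Baire's theorem, the summation of a dyadic series as in the open mapping theorem, and Hahn-Banach.

  A second use of the multiplier theorem yields the equivalence: if \<open>(f \<oplus>\<^sub>2 g)\<^sup>@ (y, y\<^sup>*) = q (y, y\<^sup>*)\<close>, then
  \<open>y\<^sup>* = u\<^sup>* + v\<^sup>*\<close> with \<open>f\<^sup>@ (y, u\<^sup>*) + g\<^sup>@ (y, v\<^sup>*) \<le> q (y, u\<^sup>*) + q (y, v\<^sup>*)\<close>, and as \<open>f\<^sup>@ \<ge> q\<close> and \<open>g\<^sup>@ \<ge> q\<close>, both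
  summands are equalities.
\<close>

section \<open>Hahn-Banach for sublinear functionals\<close>

definition sublinear :: "('a::real_vector \<Rightarrow> real) \<Rightarrow> bool" where
  "sublinear p \<longleftrightarrow> (\<forall>x y. p (x + y) \<le> p x + p y) \<and> (\<forall>c x. 0 < c \<longrightarrow> p (c *\<^sub>R x) = c * p x)"

lemma sublinearD:
  assumes "sublinear p"
  shows sublinear_add: "p (x + y) \<le> p x + p y"
    and sublinear_scaleR: "0 < c \<Longrightarrow> p (c *\<^sub>R x) = c * p x"
    and sublinear_zero: "p 0 = 0"
    and sublinear_uminus: "- p (- x) \<le> p x"
proof -
  show add: "p (x + y) \<le> p x + p y" for x y
    using assms by (simp add: sublinear_def)
  show sc: "0 < c \<Longrightarrow> p (c *\<^sub>R x) = c * p x" for c x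
    using assms by (simp add: sublinear_def)
  show zero: "p 0 = 0"
    using sc[of 2 0] by simp
  show "- p (- x) \<le> p x"
    using add[of x "- x"] zero by simp
qed

text \<open>
  The functional \<open>q x = inf {p (x + y) + s | (y, s) \<in> C}\<close> is the largest sublinear one below \<open>p\<close> with
  \<open>q (- y) \<le> s\<close> on \<open>C\<close>. With \<open>C\<close> the ray through \<open>(x, - p x)\<close> it shows that minimal sublinear functionals are
  odd; with the cone over a convex set it carries a constraint over to the linear functionals below \<open>q\<close>.
\<close>

lemma sublinear_reduce_along_cone:
  fixes p :: "'a::real_vector \<Rightarrow> real" and C :: "('a \<times> real) set"
  assumes p: "sublinear p" and zero: "0 \<in> C"
    and add: "\<And>b c. b \<in> C \<Longrightarrow> c \<in> C \<Longrightarrow> b + c \<in> C"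
    and scale: "\<And>l c. 0 < l \<Longrightarrow> c \<in> C \<Longrightarrow> l *\<^sub>R c \<in> C"
    and nonneg: "\<And>y s. (y, s) \<in> C \<Longrightarrow> 0 \<le> p y + s"
  obtains q where "sublinear q" "\<And>x. q x \<le> p x" "\<And>y s. (y, s) \<in> C \<Longrightarrow> q (- y) \<le> s"
proof -
  define q where "q x = (INF (y, s)\<in>C. p (x + y) + s)" for x
  have bound: "- p (- x) \<le> p (x + y) + s" if "(y, s) \<in> C" for x y s
    using nonneg[OF that] sublinear_add[OF p, of "x + y" "- x"] by simp
  have lower: "q x \<le> p (x + y) + s" if "(y, s) \<in> C" for x y s
  proof -
    have "bdd_below ((\<lambda>(y, s). p (x + y) + s) ` C)"
      using bound by (intro bdd_belowI[of _ "- p (- x)"]) auto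
    from cINF_lower[OF this that] show ?thesis
      by (simp add: q_def)
  qed
  have greatest: "t \<le> q x" if "\<And>y s. (y, s) \<in> C \<Longrightarrow> t \<le> p (x + y) + s" for t x
    unfolding q_def using zero that by (intro cINF_greatest) auto
  have q_add: "q (x + x') \<le> q x + q x'" for x x'
  proof -
    have "q (x + x') - q x' \<le> p (x + y) + s" if c: "(y, s) \<in> C" for y s
    proof -
      have "q (x + x') - (p (x + y) + s) \<le> p (x' + y') + s'" if c': "(y', s') \<in> C" for y' s'
      proof -
        have "(y + y', s + s') \<in> C"
          using add[OF c c'] by simp
        from lower[OF this, of "x + x'"]
        show ?thesis
          using sublinear_add[OF p, of "x + y" "x' + y'"] by (simp add: algebra_simps)
      qed
      from greatest[OF this] show ?thesis by simp
    qed
    from greatest[OF this] show ?thesis by simp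
  qed
  have q_le: "q (c *\<^sub>R x) \<le> c * q x" if "0 < c" for c x
  proof -
    have "q (c *\<^sub>R x) / c \<le> p (x + y) + s" if "(y, s) \<in> C" for y s
    proof -
      have "(c *\<^sub>R y, c * s) \<in> C"
        using scale[OF \<open>0 < c\<close> that] by simp
      from lower[OF this, of "c *\<^sub>R x"]
      have "q (c *\<^sub>R x) \<le> c * (p (x + y) + s)"
        using sublinear_scaleR[OF p \<open>0 < c\<close>, of "x + y"] by (simp add: algebra_simps)
      then show ?thesis
        using \<open>0 < c\<close> by (simp add: field_simps)
    qed
    from greatest[OF this] show ?thesis
      using \<open>0 < c\<close> by (simp add: field_simps)
  qed
  have q_scale: "q (c *\<^sub>R x) = c * q x" if "0 < c" for c x
    using q_le[OF that, of x] q_le[of "inverse c" "c *\<^sub>R x"] that by (simp add: field_simps)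
  show thesis
  proof
    show "sublinear q"
      using q_add q_scale by (simp add: sublinear_def)
    show "q x \<le> p x" for x
      using lower[of 0 0 x] zero by (simp add: zero_prod_def)
    show "q (- y) \<le> s" if "(y, s) \<in> C" for y s
      using lower[OF that, of "- y"] sublinear_zero[OF p] by simp
  qed
qed

lemma minimal_sublinear_linear:
  assumes p: "sublinear p" and minimal: "\<And>q. sublinear q \<Longrightarrow> (\<And>x. q x \<le> p x) \<Longrightarrow> q = p"
  shows "linear p"
proof -
  have neg: "p (- x) = - p x" for x
  proof -
    define C where "C = {(t *\<^sub>R x, - (t * p x)) | t. 0 \<le> t}"
    obtain q where q: "sublinear q" "\<And>y. q y \<le> p y" "\<And>y s. (y, s) \<in> C \<Longrightarrow> q (- y) \<le> s"
    proof (rule sublinear_reduce_along_cone[OF p, of C])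
      show "0 \<in> C"
        by (auto simp: C_def zero_prod_def intro: exI[of _ 0])
      show "b + c \<in> C" if "b \<in> C" "c \<in> C" for b c
      proof -
        from that obtain t u where "0 \<le> t" "0 \<le> u" "b = (t *\<^sub>R x, - (t * p x))"
          "c = (u *\<^sub>R x, - (u * p x))"
          by (auto simp: C_def)
        then show ?thesis
          by (auto simp: C_def algebra_simps intro!: exI[of _ "t + u"])
      qed
      show "l *\<^sub>R c \<in> C" if "0 < l" "c \<in> C" for l c
      proof -
        from that obtain t where "0 \<le> t" "c = (t *\<^sub>R x, - (t * p x))"
          by (auto simp: C_def)
        then show ?thesis
          using \<open>0 < l\<close> by (auto simp: C_def intro!: exI[of _ "l * t"])
      qed
      show "0 \<le> p y + s" if "(y, s) \<in> C" for y s
      proof -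
        from that obtain t where "0 \<le> t" "y = t *\<^sub>R x" "s = - (t * p x)"
          by (auto simp: C_def)
        then show ?thesis
          using sublinear_scaleR[OF p, of t x] sublinear_zero[OF p] by (cases "t = 0") auto
      qed
    qed blast
    have "(x, - p x) \<in> C"
      by (auto simp: C_def intro: exI[of _ 1])
    from q(3)[OF this] have "p (- x) \<le> - p x"
      using minimal[OF q(1,2)] by simp
    then show ?thesis
      using sublinear_uminus[OF p, of x] by simp
  qed
  show ?thesis
  proof
    show "p (x + y) = p x + p y" for x y
      using sublinear_add[OF p, of x y] sublinear_add[OF p, of "- x" "- y"] neg[of x] neg[of y]
        neg[of "x + y"] by simp
    show "p (c *\<^sub>R x) = c *\<^sub>R p x" for c x
    proof -
      consider "0 < c" | "c = 0" | "0 < - c" by linarith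
      then show ?thesis
      proof cases
        case 3
        then show ?thesis
          using sublinear_scaleR[OF p, of "- c" x] neg[of "c *\<^sub>R x"] by simp
      qed (use sublinear_scaleR[OF p] sublinear_zero[OF p] in auto)
    qed
  qed
qed

text \<open>
  A minimal sublinear functional below \<open>p\<close> exists by Zorn's lemma: the pointwise infimum of a chain is
  finite, as every member satisfies \<open>- p (- x) \<le> q x\<close>, and subadditive, as two members of a chain can be
  replaced by the smaller one.
\<close>

lemma exists_linear_le_sublinear:
  assumes p: "sublinear p"
  obtains L where "linear L" "\<And>x. L x \<le> p x"
proof -
  define A where "A = {q. sublinear q \<and> q \<le> p}"
  have "\<exists>m\<in>A. \<forall>a\<in>A. m \<ge> a \<longrightarrow> a = m"
  proof (rule predicate_Zorn)
    show "partial_order_on A (relation_of (\<ge>) A)"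
      by (auto simp: partial_order_on_def preorder_on_def relation_of_def refl_on_def trans_def
          antisym_def)
    fix C assume chain: "C \<in> Chains (relation_of (\<ge>) A)"
    then have CA: "C \<subseteq> A" and tot: "\<And>a b. a \<in> C \<Longrightarrow> b \<in> C \<Longrightarrow> a \<le> b \<or> b \<le> a"
      by (auto simp: Chains_def relation_of_def)
    show "\<exists>u\<in>A. \<forall>a\<in>C. a \<ge> u"
    proof (cases "C = {}")
      case True
      then show ?thesis
        using p by (auto simp: A_def)
    next
      case False
      define u where "u x = (INF q\<in>C. q x)" for x
      have bdd: "bdd_below ((\<lambda>q. q x) ` C)" for x
      proof (rule bdd_belowI[of _ "- p (- x)"])
        fix v assume "v \<in> (\<lambda>q. q x) ` C"
        then obtain q where "q \<in> C" "v = q x" by auto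
        with CA have "sublinear q" "q (- x) \<le> p (- x)"
          by (auto simp: A_def le_fun_def)
        with sublinear_uminus[of q x] show "- p (- x) \<le> v"
          using \<open>v = q x\<close> by simp
      qed
      have low: "u x \<le> q x" if "q \<in> C" for q x
        unfolding u_def using bdd that by (rule cINF_lower)
      have great: "t \<le> u x" if "\<And>q. q \<in> C \<Longrightarrow> t \<le> q x" for t x
        unfolding u_def using False that by (rule cINF_greatest)
      have sub: "sublinear q" if "q \<in> C" for q
        using that CA by (auto simp: A_def)
      have "u (x + y) \<le> u x + u y" for x y
      proof -
        have "u (x + y) - u y \<le> q x" if q: "q \<in> C" for q
        proof -
          have "u (x + y) - q x \<le> r y" if r: "r \<in> C" for r
          proof -
            have *: "u (x + y) \<le> q x + q y" "u (x + y) \<le> r x + r y"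
              using low[OF q, of "x + y"] sublinear_add[OF sub[OF q], of x y]
                low[OF r, of "x + y"] sublinear_add[OF sub[OF r], of x y] by linarith+
            from tot[OF q r] show ?thesis
            proof
              assume "q \<le> r"
              with * show ?thesis by (auto simp: le_fun_def intro: order_trans dest!: spec[of _ y])
            next
              assume "r \<le> q"
              with * show ?thesis by (auto simp: le_fun_def intro: order_trans dest!: spec[of _ x])
            qed
          qed
          then have "u (x + y) - q x \<le> u y" by (rule great)
          then show ?thesis by simp
        qed
        then have "u (x + y) - u y \<le> u x" by (rule great)
        then show ?thesis by simp
      qed
      moreover have le: "c * u x \<le> u (c *\<^sub>R x)" if "0 < c" for c x
      proof (rule great)
        fix q assume "q \<in> C"
        then show "c * u x \<le> q (c *\<^sub>R x)"
          using low[of q x] sublinear_scaleR[OF sub, of q c x] that by simp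
      qed
      moreover have "u (c *\<^sub>R x) = c * u x" if "0 < c" for c x
        using le[OF that, of x] le[of "inverse c" "c *\<^sub>R x"] that by (simp add: field_simps)
      ultimately have "sublinear u"
        by (simp add: sublinear_def)
      moreover have "u \<le> p"
      proof -
        from False obtain q where "q \<in> C" by auto
        then show ?thesis
          using low[of q] CA by (auto simp: A_def le_fun_def intro: order_trans)
      qed
      ultimately show ?thesis
        using low by (auto simp: A_def le_fun_def)
    qed
  qed
  then obtain m where m: "sublinear m" "m \<le> p" "\<And>q. sublinear q \<Longrightarrow> q \<le> p \<Longrightarrow> q \<le> m \<Longrightarrow> q = m"
    by (auto simp: A_def)
  have "linear m"
    using m(1)
  proof (rule minimal_sublinear_linear)
    fix q assume "sublinear q" "\<And>x. q x \<le> m x"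
    then show "q = m"
      using m(2) by (intro m(3)) (auto simp: le_fun_def intro: order_trans)
  qed
  then show thesis
    using m(2) that by (auto simp: le_fun_def)
qed

text \<open>
  A linear functional below \<open>p\<close> can preserve the inequality \<open>0 \<le> p y + s\<close> simultaneously on a convex set
  of pairs. The norm penalties of the next section are replaced by linear multipliers in this way.
\<close>

lemma Hahn_Banach_Lagrange:
  fixes p :: "'a::real_vector \<Rightarrow> real" and D :: "('a \<times> real) set"
  assumes p: "sublinear p" and D: "convex D" and nonneg: "\<And>y s. (y, s) \<in> D \<Longrightarrow> 0 \<le> p y + s"
  obtains L where "linear L" "\<And>y. L y \<le> p y" "\<And>y s. (y, s) \<in> D \<Longrightarrow> 0 \<le> L y + s"
proof -
  define C where "C = insert 0 {l *\<^sub>R d | l d. 0 < l \<and> d \<in> D}"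
  obtain q where q: "sublinear q" "\<And>x. q x \<le> p x" "\<And>y s. (y, s) \<in> C \<Longrightarrow> q (- y) \<le> s"
  proof (rule sublinear_reduce_along_cone[OF p, of C])
    show "0 \<in> C"
      by (simp add: C_def)
    show "b + c \<in> C" if "b \<in> C" "c \<in> C" for b c
    proof (cases "b = 0 \<or> c = 0")
      case False
      with that obtain l d l' d' where bc: "0 < l" "0 < l'" "d \<in> D" "d' \<in> D" "b = l *\<^sub>R d" "c = l' *\<^sub>R d'"
        by (auto simp: C_def)
      have "(l / (l + l')) *\<^sub>R d + (l' / (l + l')) *\<^sub>R d' \<in> D"
        using bc D by (intro convexD) (auto simp: add_divide_distrib[symmetric])
      moreover have "b + c = (l + l') *\<^sub>R ((l / (l + l')) *\<^sub>R d + (l' / (l + l')) *\<^sub>R d')"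
        using bc by (simp add: scaleR_right_distrib)
      ultimately show ?thesis
        using bc(1,2) unfolding C_def
        by (intro insertI2 CollectI exI[of _ "l + l'"] exI conjI) (assumption | simp)+
    qed (use that in auto)
    show "l *\<^sub>R c \<in> C" if "0 < l" "c \<in> C" for l c
    proof (cases "c = 0")
      case False
      with that obtain l' d where "0 < l'" "d \<in> D" "c = l' *\<^sub>R d"
        by (auto simp: C_def)
      then have "0 < l * l'" "l *\<^sub>R c = (l * l') *\<^sub>R d"
        using \<open>0 < l\<close> by auto
      with \<open>d \<in> D\<close> show ?thesis
        unfolding C_def by blast
    qed (use that in auto)
    show "0 \<le> p y + s" if "(y, s) \<in> C" for y s
    proof (cases "(y, s) = 0")
      case True
      then show ?thesis
        using sublinear_zero[OF p] by (simp add: zero_prod_def)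
    next
      case False
      with that obtain l y' s' where l: "0 < l" "(y', s') \<in> D" "y = l *\<^sub>R y'" "s = l * s'"
        by (auto simp: C_def)
      then have "p y + s = l * (p y' + s')"
        using sublinear_scaleR[OF p, of l y'] by (simp add: algebra_simps)
      then show ?thesis
        using l nonneg by simp
    qed
  qed blast
  obtain L where L: "linear L" "\<And>x. L x \<le> q x"
    using exists_linear_le_sublinear[OF q(1)] by blast
  show thesis
  proof (rule that[OF L(1)])
    show "L y \<le> p y" for y
      using L(2) q(2) order_trans by blast
    show "0 \<le> L y + s" if "(y, s) \<in> D" for y s
    proof -
      have "1 *\<^sub>R (y, s) \<in> C"
        unfolding C_def using that zero_less_one by blast
      then have "q (- y) \<le> s"
        using q(3) by simp
      then show ?thesis
        using L(2)[of "- y"] linear_neg[OF L(1), of y] by simp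
    qed
  qed
qed

section \<open>Lagrange multipliers under a closed subspace condition\<close>

lemma linear_bounded_by_norm:
  assumes "linear L" and "\<And>x. L x \<le> K * norm x"
  shows "bounded_linear (L :: 'a::real_normed_vector \<Rightarrow> real)"
proof (rule bounded_linear_intro[of L K])
  show "L (x + y) = L x + L y" for x y
    by (rule linear_add[OF assms(1)])
  show "L (r *\<^sub>R x) = r *\<^sub>R L x" for r x
    by (rule linear_scale[OF assms(1)])
  show "norm (L x) \<le> norm x * K" for x
    using assms(2)[of x] assms(2)[of "- x"] linear_neg[OF assms(1), of x] by (simp add: mult.commute)
qed

lemma dyadic_combination_mem:
  fixes H :: "'z::real_vector set"
  assumes H: "convex H" and z: "\<And>i. z i \<in> H" and "a \<in> H"
  shows "(\<Sum>i<n. (1/2)^Suc i *\<^sub>R z i) + (1/2)^n *\<^sub>R a \<in> H"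
  using \<open>a \<in> H\<close>
proof (induction n arbitrary: a)
  case (Suc n)
  have "(1/2) *\<^sub>R z n + (1/2) *\<^sub>R a \<in> H"
    using H z Suc.prems by (intro convexD) auto
  from Suc.IH[OF this] show ?case
    by (simp add: scaleR_right_distrib add.assoc mult.commute)
qed simp

text \<open>
  The summation step of the open mapping theorem, inside one convex set: writing \<open>2 w\<close> as
  \<open>T z\<^sub>0\<close> plus an error of size \<open>r / 2\<close>, doubling the error and repeating gives \<open>w = \<Sum>i. 2\<^sup>-\<^sup>i\<^sup>-\<^sup>1 T z\<^sub>i\<close>, and the
  infinite convex combination of the \<open>z\<^sub>i\<close> stays in the closed convex set \<open>H\<close>.
\<close>

lemma almost_onto_imp_onto:
  fixes T :: "'z::banach \<Rightarrow> 'y::real_normed_vector"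
  assumes T: "bounded_linear T" and H: "closed H" "convex H" "bounded H" 
    and F: "subspace F" "T ` H \<subseteq> F"
    and almost: "\<And>w. w \<in> F \<Longrightarrow> norm w < r \<Longrightarrow> w \<in> closure (T ` H)"
    and w: "w \<in> F" "norm w < r / 2"
  shows "w \<in> T ` H"
proof -
  interpret T: bounded_linear T by fact
  have r: "0 < r" using w norm_ge_zero[of w] by linarith
  have "\<exists>z\<in>H. norm (v - T z) < r / 2" if "v \<in> F" "norm v < r" for v
    using almost[OF that] r closure_approachable[of v "T ` H"]
    by (force simp: dist_norm norm_minus_commute dest: spec[of _ "r / 2"])
  then obtain pick where pick: "\<And>v. v \<in> F \<Longrightarrow> norm v < r \<Longrightarrow> pick v \<in> H \<and> norm (v - T (pick v)) < r / 2"
    by metis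
  define v where "v = rec_nat (2 *\<^sub>R w) (\<lambda>_ u. 2 *\<^sub>R (u - T (pick u)))"
  have v0: "v 0 = 2 *\<^sub>R w" and vSuc: "v (Suc n) = 2 *\<^sub>R (v n - T (pick (v n)))" for n
    by (simp_all add: v_def)
  define z where "z n = pick (v n)" for n
  have v: "v n \<in> F \<and> norm (v n) < r" for n
  proof (induction n)
    case 0
    then show ?case using w F by (simp add: v0 subspace_scale)
  next
    case (Suc n)
    then show ?case
      using pick[of "v n"] F by (auto simp: vSuc intro!: subspace_scale subspace_diff)
  qed
  have z: "z n \<in> H" for n
    using v pick by (simp add: z_def)
  obtain N where N: "\<And>h. h \<in> H \<Longrightarrow> norm h \<le> N"
    using \<open>bounded H\<close> by (auto simp: bounded_iff)
  have sum: "summable (\<lambda>i. (1/2)^Suc i *\<^sub>R z i)"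
  proof (rule summable_comparison_test)
    show "\<exists>M. \<forall>n\<ge>M. norm ((1/2)^Suc n *\<^sub>R z n) \<le> N * (1/2)^Suc n"
      using N[OF z] by (auto simp: mult.commute intro!: mult_right_mono)
    show "summable (\<lambda>n. N * (1/2::real)^Suc n)"
      by (intro summable_mult) (simp only: summable_Suc_iff, intro summable_geometric, simp)
  qed
  define s where "s = (\<Sum>i. (1/2)^Suc i *\<^sub>R z i)"
  have lim: "(\<lambda>n. \<Sum>i<n. (1/2)^Suc i *\<^sub>R z i) \<longlonglongrightarrow> s"
    using summable_sums[OF sum] by (simp add: sums_def s_def)
  have half: "(\<lambda>n. (1/2::real)^n) \<longlonglongrightarrow> 0"
    by (intro LIMSEQ_power_zero) simp
  have "(\<lambda>n. (\<Sum>i<n. (1/2)^Suc i *\<^sub>R z i) + (1/2)^n *\<^sub>R z 0) \<longlonglongrightarrow> s + 0 *\<^sub>R z 0"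
    by (intro tendsto_intros lim half)
  then have "s + 0 *\<^sub>R z 0 \<in> H"
    by (rule closed_sequentially[OF \<open>closed H\<close> dyadic_combination_mem[OF \<open>convex H\<close> z z]])
  then have "s \<in> H" by simp
  have rem: "w - T (\<Sum>i<n. (1/2)^Suc i *\<^sub>R z i) = (1/2)^Suc n *\<^sub>R v n" for n
  proof (induction n)
    case (Suc n)
    have "w - T (\<Sum>i<Suc n. (1/2)^Suc i *\<^sub>R z i) = (1/2)^Suc n *\<^sub>R v n - (1/2)^Suc n *\<^sub>R T (z n)"
      unfolding Suc[symmetric] by (simp add: T.add T.scaleR)
    then show ?case
      by (simp add: vSuc z_def scaleR_right_diff_distrib)
  qed (simp add: v0 T.zero)
  have "(\<lambda>n. w - T (\<Sum>i<n. (1/2)^Suc i *\<^sub>R z i)) \<longlonglongrightarrow> w - T s"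
    by (intro tendsto_intros T.tendsto lim)
  moreover have "(\<lambda>n. (1/2)^Suc n *\<^sub>R v n) \<longlonglongrightarrow> 0"
  proof (rule Lim_null_comparison)
    show "\<forall>\<^sub>F n in sequentially. norm ((1/2)^Suc n *\<^sub>R v n) \<le> (1/2)^Suc n * r"
      using v by (auto intro!: always_eventually mult_left_mono less_imp_le)
    show "(\<lambda>n. (1/2)^Suc n * r) \<longlonglongrightarrow> 0"
      using tendsto_mult[OF LIMSEQ_Suc[OF half] tendsto_const[of r]] by simp
  qed
  ultimately have "w - T s = 0"
    unfolding rem by (rule LIMSEQ_unique)
  then show ?thesis
    using \<open>s \<in> H\<close> by auto
qed

text \<open>
  The sets \<open>n T (G \<inter> cball 0 n)\<close> exhaust the complete space \<open>F\<close>, so by Baire's theorem the closure of one of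
  them has interior in \<open>F\<close>. Averaging with the opposite of an interior point, which lies in a set of larger index,
  moves the interior to \<open>0\<close>. A point of \<open>G\<close> in the kernel of \<open>T\<close> makes the sets increasing for large \<open>n\<close>.
\<close>

lemma absorbing_cone_nbhd:
  fixes T :: "'z::banach \<Rightarrow> 'y::banach"
  assumes T: "bounded_linear T" and G: "closed G" "convex G"
    and F_def: "F = (\<Union>l\<in>{0::real<..}. (*\<^sub>R) l ` T ` G)" and F: "subspace F" "closed F"
  obtains r N where "0 < r" "\<And>w. w \<in> F \<Longrightarrow> norm w < r \<Longrightarrow> \<exists>z\<in>G. T z = w \<and> norm z \<le> N"
proof -
  interpret T: bounded_linear T by fact
  have "0 \<in> F" using F(1) by (rule subspace_0)
  then obtain z0 where z0: "z0 \<in> G" "T z0 = 0"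
    by (auto simp: F_def)
  define S where "S n = T ` (G \<inter> cball 0 n)" for n :: real
  have convS: "convex (S n)" for n
    unfolding S_def using G by (intro convex_linear_image T.linear convex_Int) auto
  have S_F: "l *\<^sub>R y \<in> F" if "y \<in> S n" "0 \<le> l" for l y n
  proof (cases "l = 0")
    case True
    then show ?thesis using \<open>0 \<in> F\<close> by simp
  next
    case False
    with that have "y \<in> T ` G" "l \<in> {0<..}"
      by (auto simp: S_def)
    then show ?thesis
      unfolding F_def by blast
  qed
  \<comment> \<open>mixing \<open>z\<close> with \<open>z0\<close>, which \<open>T\<close> annihilates, trades the factor \<open>l\<close> for any larger \<open>n\<close>\<close>
  have grow: "\<exists>y\<in>S n. w = real n *\<^sub>R y"
    if "z \<in> G" "w = l *\<^sub>R T z" "0 \<le> l" "l \<le> n" "norm z \<le> n" "norm z0 \<le> n" "0 < n" for z w l n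
  proof
    define z' where "z' = (1 - l / n) *\<^sub>R z0 + (l / n) *\<^sub>R z"
    have "z' \<in> G \<inter> cball 0 n"
      unfolding z'_def using that z0 G by (intro convexD_alt[OF convex_Int]) auto
    then show "T z' \<in> S n"
      by (simp add: S_def)
    show "w = real n *\<^sub>R T z'"
      using that z0 by (simp add: z'_def T.add T.scaleR)
  qed
  define D where "D n = closure ((*\<^sub>R) (real n) ` S n)" for n :: nat
  have D_F: "D n \<subseteq> F" for n
    unfolding D_def using F S_F by (intro closure_minimal) auto
  have cover: "\<exists>m. \<forall>n\<ge>m. w \<in> (*\<^sub>R) (real n) ` S n" if "w \<in> F" for w
  proof -
    from that obtain l z where lz: "0 < l" "z \<in> G" "w = l *\<^sub>R T z"
      by (auto simp: F_def)
    obtain m where m: "l + norm z + norm z0 \<le> real m"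
      using real_arch_simple by blast
    show ?thesis
    proof (intro exI allI impI)
      fix n assume "m \<le> n"
      then have "l + norm z + norm z0 \<le> real n" using m by linarith
      then have "l \<le> n" "norm z \<le> n" "norm z0 \<le> n" "0 < n"
        using lz norm_ge_zero[of z] norm_ge_zero[of z0] by linarith+
      then show "w \<in> (*\<^sub>R) (real n) ` S n"
        using grow[of z w l n] lz by auto
    qed
  qed
  have "\<exists>n U. openin (top_of_set F) U \<and> U \<noteq> {} \<and> U \<subseteq> D n"
  proof (rule ccontr)
    assume none: "\<not> ?thesis"
    have "(top_of_set F) interior_of (\<Union>(range D)) = {}"
    proof (rule Baire_category_alt)
      show "completely_metrizable_space (top_of_set F) \<or>
          locally_compact_space (top_of_set F) \<and> regular_space (top_of_set F)"
        using F(2) completely_metrizable_space_closedin[OF completely_metrizable_space_euclidean]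
        by auto
      show "closedin (top_of_set F) T' \<and> top_of_set F interior_of T' = {}" if "T' \<in> range D" for T'
      proof -
        from that obtain n where n: "T' = D n" by auto
        have "closedin (top_of_set F) (D n)"
          using D_F[of n] by (intro closed_subset) (auto simp: D_def)
        moreover have "top_of_set F interior_of D n = {}"
          using none unfolding interior_of_eq_empty by blast
        ultimately show ?thesis by (simp add: n)
      qed
    qed auto
    moreover have "\<Union>(range D) = F"
    proof
      show "\<Union>(range D) \<subseteq> F" using D_F by auto
      show "F \<subseteq> \<Union>(range D)"
        using cover closure_subset unfolding D_def by fast
    qed
    ultimately show False
      using \<open>0 \<in> F\<close> interior_of_topspace[of "top_of_set F"] by auto
  qed
  then obtain n w0 e where n: "w0 \<in> F" "0 < e" "\<And>w. w \<in> F \<Longrightarrow> dist w w0 < e \<Longrightarrow> w \<in> D n"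
    unfolding openin_euclidean_subtopology_iff by blast
  obtain m where m: "\<And>k. k \<ge> m \<Longrightarrow> - w0 \<in> (*\<^sub>R) (real k) ` S k"
    using cover[of "- w0"] subspace_neg[OF F(1) n(1)] by blast
  obtain m0 :: nat where m0: "norm z0 \<le> m0"
    using real_arch_simple by blast
  define k where "k = Suc (max n (max m m0))"
  have k: "n \<le> k" "m \<le> k" "m0 \<le> k" "0 < k"
    by (auto simp: k_def)
  define Sk where "Sk = (*\<^sub>R) (real k) ` S k"
  have "(*\<^sub>R) (real n) ` S n \<subseteq> Sk"
  proof
    fix w assume "w \<in> (*\<^sub>R) (real n) ` S n"
    then obtain z where "z \<in> G" "norm z \<le> n" "w = real n *\<^sub>R T z"
      by (auto simp: S_def)
    then show "w \<in> Sk"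
      using grow[of z w "real n" k] k m0 by (auto simp: Sk_def)
  qed
  then have Dk: "D n \<subseteq> closure Sk"
    unfolding D_def by (rule closure_mono)
  have convSk: "convex (closure Sk)"
    unfolding Sk_def using convS by (intro convex_closure convex_scaling)
  have nbhd: "w \<in> closure (S k)" if "w \<in> F" "norm w < e / (2 * k)" for w
  proof -
    have "w0 + (2 * real k) *\<^sub>R w \<in> D n"
      using that n k F by (intro n(3)) (auto simp: dist_norm field_simps intro!: subspace_add subspace_scale)
    then have "(1/2) *\<^sub>R (w0 + (2 * real k) *\<^sub>R w) + (1/2) *\<^sub>R (- w0) \<in> closure Sk"
      using Dk m[OF k(2)] closure_subset[of Sk] by (intro convexD[OF convSk]) (auto simp: Sk_def)
    then have "real k *\<^sub>R w \<in> closure Sk"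
      by (simp add: scaleR_right_distrib)
    then have "(1 / real k) *\<^sub>R real k *\<^sub>R w \<in> (*\<^sub>R) (1 / real k) ` closure Sk"
      by blast
    also have "\<dots> = closure ((*\<^sub>R) (1 / real k) ` Sk)"
      by (rule closure_scaleR)
    also have "(*\<^sub>R) (1 / real k) ` Sk = S k"
      using k by (auto simp: Sk_def image_image)
    finally show ?thesis using k by simp
  qed
  show thesis
  proof
    show "0 < e / (2 * k) / 2" using n k by simp
    fix w assume w: "w \<in> F" "norm w < e / (2 * k) / 2"
    have "w \<in> T ` (G \<inter> cball 0 k)"
    proof (rule almost_onto_imp_onto[OF T])
      show "T ` (G \<inter> cball 0 (real k)) \<subseteq> F"
        using S_F[of _ k 1] by (auto simp: S_def)
      show "w \<in> closure (T ` (G \<inter> cball 0 (real k)))" if "w \<in> F" "norm w < e / (2 * k)" for w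
        using nbhd[OF that] by (simp add: S_def)
    qed (use G F w in \<open>auto intro: convex_Int closed_Int bounded_Int\<close>)
    then show "\<exists>z\<in>G. T z = w \<and> norm z \<le> real k"
      by auto
  qed
qed

text \<open>
  A solution \<open>z' \<in> G\<close> of \<open>T z' = - T z / t\<close> of bounded norm mixes with \<open>z\<close> to a feasible point, and taking \<open>t\<close>
  proportional to \<open>\<parallel>T z\<parallel>\<close> shows that \<open>\<rho>\<close> can fall below \<open>m\<close> by at most a multiple of \<open>\<parallel>T z\<parallel>\<close>. This norm
  penalty is sublinear, hence can be made linear. The objective is linear because a convex one
  can be moved into the constraint set \<open>G\<close> by passing to its epigraph.
\<close>

theorem Lagrange_multiplier:
  fixes T :: "'z::banach \<Rightarrow> 'y::banach" and \<rho> :: "'z \<Rightarrow> real"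
  assumes T: "bounded_linear T" and \<rho>: "bounded_linear \<rho>" and G: "closed G" "convex G"
    and F_def: "F = (\<Union>l\<in>{0::real<..}. (*\<^sub>R) l ` T ` G)" and F: "subspace F" "closed F"
    and m: "\<And>z. z \<in> G \<Longrightarrow> T z = 0 \<Longrightarrow> m \<le> \<rho> z"
  obtains u where "bounded_linear u" "\<And>z. z \<in> G \<Longrightarrow> m \<le> \<rho> z + u (T z)"
proof -
  interpret T: bounded_linear T by fact
  interpret \<rho>: bounded_linear \<rho> by fact
  obtain r N where r: "0 < r" and N: "\<And>w. w \<in> F \<Longrightarrow> norm w < r \<Longrightarrow> \<exists>z\<in>G. T z = w \<and> norm z \<le> N"
    using absorbing_cone_nbhd[OF T G F_def F] by blast
  obtain B where B: "0 < B" "\<And>z. norm (\<rho> z) \<le> norm z * B"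
    using \<rho>.pos_bounded by blast
  define K where "K = 2 * (\<bar>m\<bar> + \<bar>N\<bar> * B) / r"
  have K: "0 \<le> K" using r B by (simp add: K_def)
  have penalty: "m \<le> \<rho> z + K * norm (T z)" if z: "z \<in> G" for z
  proof (cases "T z = 0")
    case True
    then show ?thesis using m z by simp
  next
    case False
    \<comment> \<open>chosen so that \<open>- T z / t\<close> has norm \<open>r / 2\<close>\<close>
    define t where "t = 2 * norm (T z) / r"
    have t: "0 < t" using False r by (simp add: t_def)
    have "1 *\<^sub>R T z \<in> F"
      unfolding F_def using z zero_less_one by blast
    then have "(- 1 / t) *\<^sub>R T z \<in> F"
      using subspace_scale[OF F(1), of "T z" "- 1 / t"] by simp
    moreover have "norm ((- 1 / t) *\<^sub>R T z) < r"
      using False r t by (simp add: t_def field_simps)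
    ultimately obtain z' where z': "z' \<in> G" "T z' = (- 1 / t) *\<^sub>R T z" "norm z' \<le> N"
      using N by blast
    define v where "v = (1 / (1 + t)) *\<^sub>R z + (t / (1 + t)) *\<^sub>R z'"
    have "v \<in> G"
      unfolding v_def using z z' t by (intro convexD[OF G(2)]) (auto simp: add_divide_distrib[symmetric])
    moreover have "T v = 0"
      using t by (simp add: v_def T.add T.scaleR z')
    ultimately have "m \<le> \<rho> v" by (rule m)
    also have "\<rho> v = (\<rho> z + t * \<rho> z') / (1 + t)"
      by (simp add: v_def \<rho>.add \<rho>.scaleR add_divide_distrib)
    finally have "m * (1 + t) \<le> \<rho> z + t * \<rho> z'"
      using t by (simp add: field_simps)
    moreover have "\<rho> z' \<le> \<bar>N\<bar> * B"
    proof -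
      have "\<rho> z' \<le> norm z' * B" using B(2)[of z'] by simp
      also have "\<dots> \<le> \<bar>N\<bar> * B" using z' B by (intro mult_right_mono) auto
      finally show ?thesis .
    qed
    then have "t * \<rho> z' \<le> t * (\<bar>N\<bar> * B)" using t by simp
    moreover have "- (t * m) \<le> t * \<bar>m\<bar>" using mult_left_mono[of "- m" "\<bar>m\<bar>" t] t by simp
    moreover have "K * norm (T z) = t * \<bar>m\<bar> + t * (\<bar>N\<bar> * B)"
      using r by (simp add: K_def t_def field_simps)
    ultimately show ?thesis by (simp add: algebra_simps)
  qed
  define D where "D = (\<lambda>z. (T z, \<rho> z - m)) ` G"
  have sub: "sublinear (\<lambda>y::'y. K * norm y)"
    unfolding sublinear_def
  proof (intro conjI allI impI)
    show "K * norm (x + y) \<le> K * norm x + K * norm y" for x y :: 'y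
      using mult_left_mono[OF norm_triangle_ineq K, of x y] by (simp add: distrib_left)
  qed simp
  have conv: "convex D"
  proof -
    have "D = (\<lambda>x. x + (0, - m)) ` (\<lambda>z. (T z, \<rho> z)) ` G"
      by (simp add: D_def image_image)
    moreover have "linear (\<lambda>z. (T z, \<rho> z))"
      by (intro bounded_linear.linear bounded_linear_Pair T \<rho>)
    ultimately show ?thesis
      using G convex_translation[OF convex_linear_image, of "\<lambda>z. (T z, \<rho> z)" G "(0, - m)"]
      by (simp add: add.commute)
  qed
  have nonneg: "0 \<le> K * norm y + s" if "(y, s) \<in> D" for y s
    using that penalty by (force simp: D_def)
  obtain L where L: "linear L" "\<And>y. L y \<le> K * norm y" "\<And>y s. (y, s) \<in> D \<Longrightarrow> 0 \<le> L y + s"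
    using Hahn_Banach_Lagrange[OF sub conv nonneg] by metis
  show thesis
  proof
    show "bounded_linear L"
      using L(1,2) by (rule linear_bounded_by_norm)
    show "m \<le> \<rho> z + L (T z)" if "z \<in> G" for z
      using L(3)[of "T z" "\<rho> z - m"] that by (auto simp: D_def)
  qed
qed

section \<open>Coincidence sets of conjugates\<close>

text \<open>
  The symmetric bilinear form with \<open>pairing b b = 2 q b\<close>; it is the pairing under which \<open>k\<^sup>@\<close> is the conjugate of \<open>k\<close>.
\<close>

definition pairing :: "'a::real_normed_vector \<times> 'a dual \<Rightarrow> 'a \<times> 'a dual \<Rightarrow> real" where
  "pairing b c = blinfun_apply (snd c) (fst b) + blinfun_apply (snd b) (fst c)"

definition r_L :: "'a::real_normed_vector \<times> 'a dual \<Rightarrow> real" where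
  "r_L d = (norm d)\<^sup>2 / 2 + q_L d"

lemma q_L_alt: "q_L b = blinfun_apply (snd b) (fst b)"
  by (simp add: q_L_def split_beta)

lemma bounded_linear_pairing: "bounded_linear (\<lambda>b. pairing b c)"
  unfolding pairing_def
  by (intro bounded_linear_add bounded_linear_compose[OF blinfun.bounded_linear_right bounded_linear_fst]
      bounded_linear_compose[OF blinfun.bounded_linear_left bounded_linear_snd])

lemma pairing_commute: "pairing b c = pairing c b"
  by (simp add: pairing_def)

lemma pairing_self: "pairing b b = 2 * q_L b"
  by (simp add: pairing_def q_L_alt)

lemma pairing_diff: "pairing (b - c) d = pairing b d - pairing c d"
  by (simp add: pairing_def blinfun.diff_right blinfun.diff_left)

lemma pairing_scaleR: "pairing (t *\<^sub>R b) c = t * pairing b c"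
  by (simp add: pairing_def blinfun.scaleR_right blinfun.scaleR_left algebra_simps)

lemma q_L_add: "q_L (b + c) = q_L b + pairing b c + q_L c"
  by (simp add: q_L_alt pairing_def blinfun.add_left blinfun.add_right)

lemma q_L_diff: "q_L (b - c) = q_L b - pairing b c + q_L c"
  by (simp add: q_L_alt pairing_def blinfun.diff_left blinfun.diff_right)

lemma q_L_scaleR: "q_L (t *\<^sub>R b) = t\<^sup>2 * q_L b"
  by (simp add: q_L_alt blinfun.scaleR_left blinfun.scaleR_right power2_eq_square)

lemma abs_q_L_le: "\<bar>q_L b\<bar> \<le> (norm b)\<^sup>2 / 2"
proof -
  have "\<bar>q_L b\<bar> \<le> norm (snd b) * norm (fst b)"
    using norm_blinfun[of "snd b" "fst b"] by (simp add: q_L_alt)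
  also have "\<dots> \<le> (norm b)\<^sup>2 / 2"
    using sum_squares_bound[of "norm (snd b)" "norm (fst b)"] by (simp add: norm_prod_def)
  finally show ?thesis .
qed

lemma abs_pairing_le: "\<bar>pairing b c\<bar> \<le> 2 * (norm b * norm c)"
proof -
  have "\<bar>pairing b c\<bar> \<le> norm (snd c) * norm (fst b) + norm (snd b) * norm (fst c)"
    unfolding pairing_def
    using norm_blinfun[of "snd c" "fst b"] norm_blinfun[of "snd b" "fst c"] by simp
  also have "\<dots> \<le> norm c * norm b + norm b * norm c"
    by (intro add_mono mult_mono norm_fst_le norm_snd_le norm_ge_zero) 
      (metis norm_fst_le norm_snd_le prod.collapse)+
  finally show ?thesis by (simp add: mult.commute)
qed

lemma r_L_nonneg: "0 \<le> r_L d"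
  using abs_q_L_le[of d] by (simp add: r_L_def)

lemma continuous_on_q_L [continuous_intros]:
  "continuous_on S f \<Longrightarrow> continuous_on S (\<lambda>x. q_L (f x))"
  unfolding q_L_alt by (intro continuous_intros)

lemma continuous_on_pairing [continuous_intros]:
  "continuous_on S f \<Longrightarrow> continuous_on S g \<Longrightarrow> continuous_on S (\<lambda>x. pairing (f x) (g x))"
  unfolding pairing_def by (intro continuous_intros)

lemma quasidense_iff_r_L:
  "quasidense A \<longleftrightarrow> (\<forall>c. \<forall>e>0. \<exists>b\<in>A. r_L (b - c) < e)"
proof -
  have r: "(norm (s - x))\<^sup>2 / 2 + (norm (s' - x'))\<^sup>2 / 2 + blinfun_apply (s' - x') (s - x)
      = r_L ((s, s') - (x, x'))" for s x :: 'a and s' x'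
    by (simp add: r_L_def q_L_alt norm_prod_def add_divide_distrib)
  have "quasidense A \<longleftrightarrow> (\<forall>c. (INF b\<in>A. ereal (r_L (b - c))) \<le> 0)"
    unfolding quasidense_def r by (simp only: split_paired_All case_prod_unfold prod.collapse)
  also have "\<dots> \<longleftrightarrow> (\<forall>c. \<forall>e>0. \<exists>b\<in>A. r_L (b - c) < e)"
  proof (intro all_cong1)
    fix c
    show "(INF b\<in>A. ereal (r_L (b - c))) \<le> 0 \<longleftrightarrow> (\<forall>e>0. \<exists>b\<in>A. r_L (b - c) < e)"
      unfolding INF_le_iff
    proof (intro iffI allI impI)
      fix e :: real assume "\<forall>y>0. \<exists>b\<in>A. ereal (r_L (b - c)) < y" "0 < e"
      then show "\<exists>b\<in>A. r_L (b - c) < e"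
        by (metis ereal_less(2) less_ereal.simps(1))
    next
      fix y :: ereal assume *: "\<forall>e>0. \<exists>b\<in>A. r_L (b - c) < e" and "0 < y"
      then obtain e where "0 < ereal e" "ereal e < y"
        by (metis ereal_dense2 zero_ereal_def)
      with * show "\<exists>b\<in>A. ereal (r_L (b - c)) < y"
        by (metis ereal_less(2) less_ereal.simps(1) order_less_trans)
    qed
  qed
  finally show ?thesis .
qed

definition above_q :: "(('a::real_normed_vector \<times> 'a dual) \<times> real) set \<Rightarrow> bool" where
  "above_q V \<longleftrightarrow> (\<forall>(b, r)\<in>V. q_L b \<le> r)"

text \<open>
  For \<open>V\<close> the epigraph of \<open>k \<ge> q\<close>, the summands \<open>k b - q b\<close> and \<open>r_L (b - c)\<close> are both nonnegative. So this says that
  near every centre \<open>c\<close>, as measured by \<open>r_L\<close>, there are points at which \<open>k\<close> nearly equals \<open>q\<close>.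
\<close>

definition nearly_touching :: "(('a::real_normed_vector \<times> 'a dual) \<times> real) set \<Rightarrow> bool" where
  "nearly_touching V \<longleftrightarrow> (\<forall>c. \<forall>e>0. \<exists>(b, r)\<in>V. r - q_L b + r_L (b - c) < e)"

lemma above_qD: "above_q V \<Longrightarrow> (b, r) \<in> V \<Longrightarrow> q_L b \<le> r"
  by (auto simp: above_q_def)

text \<open>
  Evaluate \<open>q \<le> r\<close> at the midpoint and use the parallelogram identity for the quadratic form \<open>q\<close>.
\<close>

lemma neg_q_L_diff_le:
  assumes V: "convex V" "above_q V" and b: "(b, r) \<in> V" and c: "(c, s) \<in> V"
  shows "- q_L (b - c) \<le> 2 * (r - q_L b) + 2 * (s - q_L c)"
proof -
  have "(1/2) *\<^sub>R (b, r) + (1/2) *\<^sub>R (c, s) \<in> V"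
    by (rule convexD[OF V(1) b c]) auto
  then have "q_L ((1/2) *\<^sub>R (b + c)) \<le> r / 2 + s / 2"
    by (intro above_qD[OF V(2)]) (simp add: scaleR_right_distrib)
  then show ?thesis
    by (simp add: q_L_scaleR q_L_add q_L_diff power2_eq_square)
qed

text \<open>
  Along the segment from \<open>b\<close> to \<open>d\<close> the difference between the convex function and \<open>q\<close> is nonnegative
  and starts at \<open>0\<close>, so its slope at \<open>b\<close> is nonnegative. The slope is \<open>s + q b - pairing d b\<close>.
\<close>

lemma touching_supports:
  assumes V: "convex V" "above_q V" and b: "(b, q_L b) \<in> V" and d: "(d, s) \<in> V"
  shows "pairing d b - s \<le> q_L b"
proof -
  define X where "X = s + q_L b - pairing d b"
  have le: "t * q_L (d - b) \<le> X" if t: "0 < t" "t < 1" for t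
  proof -
    have "(1 - t) *\<^sub>R (b, q_L b) + t *\<^sub>R (d, s) \<in> V"
      using t by (intro convexD[OF V(1) b d]) auto
    then have "q_L ((1 - t) *\<^sub>R b + t *\<^sub>R d) \<le> (1 - t) * q_L b + t * s"
      by (intro above_qD[OF V(2)]) simp
    also have "(1 - t) *\<^sub>R b + t *\<^sub>R d = b + t *\<^sub>R (d - b)"
      by (simp add: algebra_simps)
    also have "q_L \<dots> = q_L b + t * pairing (d - b) b + t\<^sup>2 * q_L (d - b)"
      by (simp add: q_L_add q_L_scaleR pairing_scaleR pairing_commute[of b])
    finally have "t * (t * q_L (d - b)) \<le> t * X"
      by (simp add: X_def pairing_diff pairing_self power2_eq_square algebra_simps)
    then show ?thesis using t by simp
  qed
  have "((\<lambda>t. t * q_L (d - b)) \<longlongrightarrow> 0 * q_L (d - b)) (at_right 0)"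
    by (intro tendsto_intros)
  moreover have "\<forall>\<^sub>F t in at_right 0. t * q_L (d - b) \<le> X"
    using le by (auto simp: eventually_at_right_field intro: exI[of _ 1])
  ultimately have "0 * q_L (d - b) \<le> X"
    by (rule tendsto_upperbound) simp
  then show ?thesis by (simp add: X_def)
qed

text \<open>
  If both gaps are of order \<open>\<epsilon>\<close>, then \<open>r_L (b' - b) < \<epsilon>\<close> controls even the norm of \<open>b' - b\<close>, because
  \<open>- q (b' - b)\<close> is bounded by the gaps. With gaps shrinking by the factor \<open>4\<close> the steps shrink by the factor \<open>2\<close>.
\<close>

lemma exists_touching_near:
  fixes V :: "(('a::banach \<times> 'a dual) \<times> real) set"
  assumes V: "closed V" "convex V" "above_q V" "nearly_touching V"
    and b0: "(b0, r0) \<in> V" "r0 - q_L b0 < e\<^sup>2" and e: "0 < e"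
  obtains b where "(b, q_L b) \<in> V" "norm (b - b0) \<le> 6 * e"
proof -
  define \<epsilon> where "\<epsilon> n = (e * (1/2)^n)\<^sup>2" for n
  have \<epsilon>_pos: "0 < \<epsilon> n" and \<epsilon>_Suc: "\<epsilon> (Suc n) = \<epsilon> n / 4" for n
    using e by (simp_all add: \<epsilon>_def power2_eq_square)
  have ex: "\<exists>p'\<in>V. snd p' - q_L (fst p') + r_L (fst p' - fst p) < \<epsilon> (Suc n)"
    for p :: "('a \<times> 'a dual) \<times> real" and n
    using V(4) \<epsilon>_pos[of "Suc n"] unfolding nearly_touching_def by (fastforce simp: split_beta)
  have "\<exists>nxt. \<forall>(p :: ('a \<times> 'a dual) \<times> real) n. nxt p n \<in> V \<and>
      snd (nxt p n) - q_L (fst (nxt p n)) + r_L (fst (nxt p n) - fst p) < \<epsilon> (Suc n)"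
  proof (intro choice allI)
    fix p :: "('a \<times> 'a dual) \<times> real" and n
    show "\<exists>p'. p' \<in> V \<and> snd p' - q_L (fst p') + r_L (fst p' - fst p) < \<epsilon> (Suc n)"
      using ex[of p n] by (simp add: Bex_def)
  qed
  then obtain nxt where "\<forall>(p :: ('a \<times> 'a dual) \<times> real) n. nxt p n \<in> V \<and>
      snd (nxt p n) - q_L (fst (nxt p n)) + r_L (fst (nxt p n) - fst p) < \<epsilon> (Suc n)" ..
  then have nxt: "nxt p n \<in> V \<and>
      snd (nxt p n) - q_L (fst (nxt p n)) + r_L (fst (nxt p n) - fst p) < \<epsilon> (Suc n)"
    for p :: "('a \<times> 'a dual) \<times> real" and n
    by (elim allE)
  define p where "p = rec_nat (b0, r0) (\<lambda>n u. nxt u n)"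
  have p0: "p 0 = (b0, r0)" and pSuc: "p (Suc n) = nxt (p n) n" for n
    by (simp_all add: p_def)
  define b r where "b n = fst (p n)" and "r n = snd (p n)" for n
  have V_n: "(b n, r n) \<in> V" for n
    using nxt b0 by (cases n) (auto simp: b_def r_def p0 pSuc)
  have gap_ge: "0 \<le> r n - q_L (b n)" for n
    using above_qD[OF V(3) V_n] by simp
  have step: "r (Suc n) - q_L (b (Suc n)) + r_L (b (Suc n) - b n) < \<epsilon> n / 4" for n
    using nxt[of "p n" n] by (simp add: b_def r_def pSuc \<epsilon>_Suc)
  have gap: "r n - q_L (b n) < \<epsilon> n" for n
    using step[of "n - 1"] r_L_nonneg[of "b n - b (n - 1)"] b0 \<epsilon>_Suc[of "n - 1"]
    by (cases n) (auto simp: b_def r_def p0 \<epsilon>_def)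
  have dist: "norm (b (Suc n) - b n) \<le> 3 * e * (1/2)^n" for n
  proof -
    have "(norm (b (Suc n) - b n))\<^sup>2 / 2 < \<epsilon> n / 4 - (r (Suc n) - q_L (b (Suc n))) - q_L (b (Suc n) - b n)"
      using step[of n] by (simp add: r_L_def)
    also have "\<dots> \<le> \<epsilon> n / 4 + (r (Suc n) - q_L (b (Suc n))) + 2 * (r n - q_L (b n))"
      using neg_q_L_diff_le[OF V(2,3) V_n[of "Suc n"] V_n[of n]] by argo
    also have "\<dots> \<le> 9/2 * \<epsilon> n"
      using gap[of n] gap[of "Suc n"] \<epsilon>_Suc[of n] \<epsilon>_pos[of n] by argo
    finally have "(norm (b (Suc n) - b n))\<^sup>2 \<le> (3 * e * (1/2)^n)\<^sup>2"
      by (simp add: \<epsilon>_def power_mult_distrib)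
    then show ?thesis
      by (rule power2_le_imp_le) (use e in simp)
  qed
  have geo: "(\<lambda>n. 3 * e * (1/2)^n) sums (3 * e * 2)"
    using sums_mult[OF geometric_sums[of "1/2::real"], of "3 * e"] by simp
  have summ: "summable (\<lambda>n. b (Suc n) - b n)"
    by (rule summable_comparison_test'[OF sums_summable[OF geo] dist])
  define a where "a = b0 + (\<Sum>n. b (Suc n) - b n)"
  have "(\<lambda>n. b0 + (\<Sum>i<n. b (Suc i) - b i)) \<longlonglongrightarrow> a"
    unfolding a_def using summable_LIMSEQ[OF summ] by (intro tendsto_intros)
  moreover have "b0 + (\<Sum>i<n. b (Suc i) - b i) = b n" for n
    by (simp add: sum_lessThan_telescope) (simp add: b_def p0)
  ultimately have lim_b: "b \<longlonglongrightarrow> a" by simp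
  have lim_q: "(\<lambda>n. q_L (b n)) \<longlonglongrightarrow> q_L a"
    using continuous_on_tendsto_compose[OF continuous_on_q_L[OF continuous_on_id, of UNIV] lim_b] by simp
  have "(\<lambda>n. (e * (1/2)^n)\<^sup>2) \<longlonglongrightarrow> (e * 0)\<^sup>2"
    by (intro tendsto_intros LIMSEQ_power_zero) simp
  then have lim_\<epsilon>: "\<epsilon> \<longlonglongrightarrow> 0" by (simp add: \<epsilon>_def[abs_def])
  have "(\<lambda>n. r n - q_L (b n)) \<longlonglongrightarrow> 0"
  proof (rule real_tendsto_sandwich[OF _ _ tendsto_const lim_\<epsilon>])
    show "\<forall>\<^sub>F n in sequentially. 0 \<le> r n - q_L (b n)"
      using gap_ge by (intro always_eventually allI)
    show "\<forall>\<^sub>F n in sequentially. r n - q_L (b n) \<le> \<epsilon> n"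
      using less_imp_le[OF gap] by (intro always_eventually allI)
  qed
  from tendsto_add[OF this lim_q] have lim_r: "r \<longlonglongrightarrow> q_L a" by simp
  show thesis
  proof
    show "(a, q_L a) \<in> V"
      using closed_sequentially[OF V(1), of "\<lambda>n. (b n, r n)"] V_n tendsto_Pair[OF lim_b lim_r] by blast
    show "norm (a - b0) \<le> 6 * e"
      using norm_suminf_le[OF dist sums_summable[OF geo]] sums_unique[OF geo] by (simp add: a_def)
  qed
qed

text \<open>
  Smallness of \<open>r_L (b - c)\<close> alone does not bound \<open>b - c\<close>, as \<open>r_L\<close> can have unbounded sublevel sets. Comparison with one fixed
  point \<open>b1\<close> of \<open>V\<close> bounds \<open>- q (b - b1)\<close>, hence \<open>- q (b - c)\<close> up to a linear term, which \<open>\<parallel>b - c\<parallel>\<^sup>2\<close> dominates.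
\<close>

lemma near_minimizers_bounded:
  assumes V: "convex V" "above_q V" and ne: "V \<noteq> {}"
  obtains M where "\<And>b r. (b, r) \<in> V \<Longrightarrow> r - q_L b + r_L (b - c) < 1 \<Longrightarrow> norm (b - c) \<le> M"
proof -
  obtain b1 r1 where b1: "(b1, r1) \<in> V" using ne by auto
  define e where "e = c - b1"
  define A where "A = 6 + 4 * (r1 - q_L b1) + 2 * \<bar>q_L e\<bar>"
  have A: "0 \<le> A" using above_qD[OF V(2) b1] by (simp add: A_def)
  show thesis
  proof
    fix b r assume b: "(b, r) \<in> V" and lt: "r - q_L b + r_L (b - c) < 1"
    define d where "d = b - c"
    have de: "b - b1 = d + e" by (simp add: d_def e_def)
    have "- q_L (d + e) \<le> 2 * (r - q_L b) + 2 * (r1 - q_L b1)"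
      using neg_q_L_diff_le[OF V b b1] de by simp
    moreover have "r - q_L b < 1" "(norm d)\<^sup>2 / 2 + q_L d < 1"
      using lt r_L_nonneg[of "b - c"] above_qD[OF V(2) b] by (simp_all add: d_def r_L_def)
    moreover define P where "P = norm e * norm d"
    moreover have "pairing d e \<le> 2 * P"
      using abs_pairing_le[of d e] by (simp add: P_def mult.commute[of "norm e"])
    moreover define Q where "Q = \<bar>q_L e\<bar>"
    moreover have "q_L e \<le> Q" by (simp add: Q_def)
    ultimately have "(norm d)\<^sup>2 \<le> 6 + 4 * (r1 - q_L b1) + 2 * Q + 4 * P"
      using q_L_add[of d e] by argo
    then have sq: "(norm d)\<^sup>2 \<le> A + 4 * norm e * norm d" by (simp add: A_def P_def Q_def)
    show "norm (b - c) \<le> A + 4 * norm e + 1"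
    proof (rule ccontr)
      assume "\<not> ?thesis"
      then have big: "A + 4 * norm e + 1 < norm d" by (simp add: d_def)
      then have d1: "1 \<le> norm d" using A norm_ge_zero[of e] by linarith
      have "(A + 4 * norm e + 1) * norm d < norm d * norm d"
        using big d1 by (intro mult_strict_right_mono) auto
      moreover have "A * 1 \<le> A * norm d" using A d1 by (rule mult_left_mono[rotated])
      ultimately show False using sq d1 by (simp add: power2_eq_square algebra_simps)
    qed
  qed
qed

text \<open>
  An approximate minimizer for \<open>c\<close> with error \<open>e\<^sup>2\<close> stays at a distance from \<open>c\<close> independent of \<open>e\<close> and
  lies within \<open>6 e\<close> of a touching point. On bounded sets, \<open>r_L\<close> changes little over such a distance.
\<close>

lemma quasidense_touching:
  fixes V :: "(('a::banach \<times> 'a dual) \<times> real) set"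
  assumes V: "closed V" "convex V" "above_q V" "nearly_touching V"
  shows "quasidense {b. (b, q_L b) \<in> V}"
  unfolding quasidense_iff_r_L
proof (intro allI impI)
  fix c and \<eta> :: real assume \<eta>: "0 < \<eta>"
  have ne: "V \<noteq> {}" using V(4) unfolding nearly_touching_def by (metis empty_iff zero_less_one)
  obtain M where M: "\<And>b r. (b, r) \<in> V \<Longrightarrow> r - q_L b + r_L (b - c) < 1 \<Longrightarrow> norm (b - c) \<le> M"
    using near_minimizers_bounded[OF V(2,3) ne] by blast
  \<comment> \<open>the error below is at most \<open>e\<^sup>2 + (6 e)\<^sup>2 + 3 \<bar>M\<bar> (6 e)\<close>, and \<open>e\<^sup>2 \<le> e\<close>\<close>
  define K where "K = 37 + 18 * \<bar>M\<bar>"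
  define e where "e = min 1 (\<eta> / (2 * K))"
  have K: "0 < K" by (simp add: K_def)
  have e: "0 < e" "e \<le> 1" "K * e < \<eta>"
    using \<eta> K by (auto simp: e_def min_def field_simps)
  have "0 < e\<^sup>2" using e by simp
  then obtain b0 r0 where b0: "(b0, r0) \<in> V" "r0 - q_L b0 + r_L (b0 - c) < e\<^sup>2"
    using V(4) unfolding nearly_touching_def by blast
  have small: "r0 - q_L b0 < e\<^sup>2" "r_L (b0 - c) < e\<^sup>2"
    using b0(2) r_L_nonneg[of "b0 - c"] above_qD[OF V(3) b0(1)] by linarith+
  have e2: "e\<^sup>2 \<le> e" using e by (simp add: power2_eq_square mult_left_le)
  then have d: "norm (b0 - c) \<le> \<bar>M\<bar>"
    using M[OF b0(1)] b0(2) e by linarith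
  obtain b where b: "(b, q_L b) \<in> V" "norm (b - b0) \<le> 6 * e"
    using exists_touching_near[OF V b0(1) small(1) e(1)] by blast
  define u v where "u = b0 - c" and "v = b - b0"
  have "r_L (u + v) = r_L u + r_L v + ((norm (u + v))\<^sup>2 - (norm u)\<^sup>2 - (norm v)\<^sup>2) / 2 + pairing u v"
    by (simp add: r_L_def q_L_add field_simps)
  also have "(norm (u + v))\<^sup>2 \<le> (norm u + norm v)\<^sup>2"
    by (intro power_mono norm_triangle_ineq norm_ge_zero)
  also have "(norm u + norm v)\<^sup>2 = (norm u)\<^sup>2 + 2 * norm u * norm v + (norm v)\<^sup>2"
    by (simp add: power2_sum)
  finally have "r_L (u + v) \<le> r_L u + r_L v + norm u * norm v + pairing u v"
    by simp
  also have "\<dots> \<le> e\<^sup>2 + (norm v)\<^sup>2 + 3 * (norm u * norm v)"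
    using small(2) abs_q_L_le[of v] abs_pairing_le[of u v] unfolding u_def[symmetric] r_L_def[of v] by linarith
  also have "\<dots> \<le> e\<^sup>2 + (6 * e)\<^sup>2 + 3 * (\<bar>M\<bar> * (6 * e))"
    using d b(2) by (intro add_mono mult_mono power_mono) (use e in \<open>auto simp: u_def v_def\<close>)
  also have "\<dots> \<le> K * e"
    using e2 by (simp add: K_def power_mult_distrib algebra_simps)
  also have "\<dots> < \<eta>" by (rule e)
  finally have "r_L (b - c) < \<eta>" by (simp add: u_def v_def)
  then show "\<exists>b\<in>{b. (b, q_L b) \<in> V}. r_L (b - c) < \<eta>"
    using b by (intro bexI[of _ b]) auto
qed

text \<open>
  The infimum defining a partial episum need not be attained, so touching points are sought in the closure of \<open>W\<close>.
  The closure inherits the hypotheses, and its touching points are coincidence points of the conjugate of \<open>W\<close>.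
\<close>

lemma coinc_conjugate_of_nearly_touching:
  fixes W :: "(('a::banach \<times> 'a dual) \<times> real) set"
  assumes W: "convex W" "above_q W" "nearly_touching W"
    and k: "\<And>c t. k c \<le> ereal t \<longleftrightarrow> (\<forall>(b, r)\<in>W. pairing b c - r \<le> t)"
  shows "ereal (q_L c) \<le> k c" and "closed (coinc k)" and "quasidense (coinc k)"
proof -
  show ge: "ereal (q_L c) \<le> k c" for c
  proof (rule ccontr)
    assume "\<not> ?thesis"
    then obtain t where t: "k c \<le> ereal t" "t < q_L c"
      by (metis ereal_dense2 less_eq_ereal_def less_ereal.simps(1) not_le)
    from W(3) t(2) obtain b r where b: "(b, r) \<in> W" "r - q_L b + r_L (b - c) < q_L c - t"
      unfolding nearly_touching_def by (metis (no_types, lifting) case_prodE diff_gt_0_iff_gt)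
    have "pairing b c - r \<le> t" using k[of c t] t b by auto
    moreover have "0 \<le> (norm (b - c))\<^sup>2" by simp
    ultimately show False using b(2) unfolding r_L_def q_L_diff by linarith
  qed
  have coinc: "coinc k = {c. \<forall>(b, r)\<in>W. pairing b c - r \<le> q_L c}"
  proof -
    have eq: "k c = ereal (q_L c) \<longleftrightarrow> k c \<le> ereal (q_L c)" for c
      using ge[of c] antisym by fastforce
    show ?thesis unfolding coinc_def eq k ..
  qed
  have "coinc k = (\<Inter>(b, r)\<in>W. {c. pairing b c - r \<le> q_L c})"
    unfolding coinc by auto
  moreover have "closed \<dots>"
    by (intro closed_INT ballI) (auto intro!: closed_Collect_le continuous_intros)
  ultimately show "closed (coinc k)" by simp
  define V where "V = closure W"
  have V: "closed V" "convex V"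
    using W(1) by (auto simp: V_def convex_closure)
  have "closed {p :: ('a \<times> 'a dual) \<times> real. q_L (fst p) \<le> snd p}"
    by (intro closed_Collect_le continuous_intros)
  then have "V \<subseteq> {p. q_L (fst p) \<le> snd p}"
    unfolding V_def using W(2) by (intro closure_minimal) (auto simp: above_q_def)
  then have V': "above_q V" by (auto simp: above_q_def)
  have WV: "W \<subseteq> V" unfolding V_def by (rule closure_subset)
  have V'': "nearly_touching V"
    unfolding nearly_touching_def
  proof (intro allI impI)
    fix c and e :: real assume "0 < e"
    then obtain p where "p \<in> W" "case p of (b, r) \<Rightarrow> r - q_L b + r_L (b - c) < e"
      using W(3) unfolding nearly_touching_def by blast
    then show "\<exists>(b, r)\<in>V. r - q_L b + r_L (b - c) < e" using WV by blast
  qed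
  have "{b. (b, q_L b) \<in> V} \<subseteq> coinc k"
    unfolding coinc
  proof (intro subsetI CollectI ballI, clarify)
    fix x x' s s' r
    assume "((x, x'), q_L (x, x')) \<in> V" "((s, s'), r) \<in> W"
    then show "pairing (s, s') (x, x') - r \<le> q_L (x, x')"
      using touching_supports[OF V(2) V'] WV by blast
  qed
  with quasidense_touching[OF V V' V''] show "quasidense (coinc k)"
    unfolding quasidense_iff_r_L by blast
qed

section \<open>Quasidensity and the bidual\<close>

text \<open>
  The conjugate of \<open>\<parallel>\<cdot>\<parallel>\<^sup>2 / 2\<close> at \<open>- e\<close> is \<open>\<parallel>e\<parallel>\<^sup>2 / 2\<close>: take \<open>d\<close> of norm \<open>\<parallel>e\<parallel>\<close> at which \<open>e\<close> nearly
  attains \<open>- \<parallel>e\<parallel>\<^sup>2\<close>.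
\<close>

lemma exists_almost_dual_vector:
  fixes e :: "'x::real_normed_vector \<Rightarrow>\<^sub>L real"
  assumes "0 < \<epsilon>"
  obtains d where "(norm d)\<^sup>2 / 2 + e d \<le> - (norm e)\<^sup>2 / 2 + \<epsilon>"
proof (cases "e = 0")
  case True
  then show thesis using that[of 0] assms by simp
next
  case False
  define n where "n = norm e"
  have n: "0 < n" using False by (simp add: n_def)
  define \<delta> where "\<delta> = min n (\<epsilon> / n)"
  have \<delta>: "0 < \<delta>" "\<delta> \<le> n" "n * \<delta> \<le> \<epsilon>"
    using n assms by (auto simp: \<delta>_def min_def field_simps)
  have "\<exists>x. (n - \<delta>) * norm x < \<bar>e x\<bar>"
  proof (rule ccontr)
    assume "\<not> ?thesis"
    then have "norm e \<le> n - \<delta>"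
      using \<delta> by (intro norm_blinfun_bound) (auto simp: not_less)
    then show False using \<delta> by (simp add: n_def)
  qed
  then obtain x where x: "(n - \<delta>) * norm x < \<bar>e x\<bar>" by blast
  have x0: "0 < norm x" using x by (cases "x = 0") (auto simp: blinfun.zero_right)
  \<comment> \<open>\<open>x\<close> rescaled to norm \<open>n\<close>, with the sign that makes \<open>e d\<close> negative\<close>
  define d where "d = (- (n * sgn (e x) / norm x)) *\<^sub>R x"
  have "e x \<noteq> 0" using x \<delta> x0 by (auto simp: mult_less_0_iff)
  then have nd: "norm d = n"
    using x0 n by (simp add: d_def abs_mult)
  have "(n - \<delta>) * n \<le> \<bar>e x\<bar> / norm x * n"
    using x x0 n by (intro mult_right_mono) (simp_all add: pos_le_divide_eq)
  moreover have "e d = - (\<bar>e x\<bar> / norm x * n)"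
    by (simp add: d_def blinfun.scaleR_right blinfun.minus_right abs_sgn mult.commute)
  ultimately have "e d \<le> - (n * n) + n * \<delta>"
    by (simp add: algebra_simps)
  then have "(norm d)\<^sup>2 / 2 + e d \<le> - (norm e)\<^sup>2 / 2 + \<epsilon>"
    using \<delta> nd by (simp add: n_def power2_eq_square)
  then show thesis by (rule that)
qed

lemma neg_blinfun_le_half_squares:
  fixes e :: "'x::real_normed_vector \<Rightarrow>\<^sub>L real"
  shows "- e x \<le> (norm e)\<^sup>2 / 2 + (norm x)\<^sup>2 / 2"
proof -
  have "- e x \<le> norm e * norm x"
    using norm_blinfun[of e x] by simp
  then show ?thesis
    using sum_squares_bound[of "norm e" "norm x"] by simp
qed

text \<open>
  For \<open>A\<close> the epigraph of \<open>k\<close>, the supremum over \<open>A\<close> of \<open>u x + Y \<xi> - r\<close> is the conjugate of \<open>k\<close> on the whole dual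
  \<open>E\<^sup>* \<times> E\<^sup>*\<^sup>*\<close>. It is to dominate \<open>Y u\<close>, the extension of \<open>q\<close> to the bidual.
\<close>

definition conjugate_above_bidual_q :: "(('a::real_normed_vector \<times> 'a dual) \<times> real) set \<Rightarrow> bool" where
  "conjugate_above_bidual_q A \<longleftrightarrow> (\<forall>(u :: 'a dual) (Y :: 'a dual \<Rightarrow>\<^sub>L real). \<forall>\<epsilon>>0.
     \<exists>x \<xi> r. ((x, \<xi>), r) \<in> A \<and> blinfun_apply Y u - \<epsilon> \<le> blinfun_apply u x + blinfun_apply Y \<xi> - r)"

text \<open>
  The bidual element \<open>Y\<close> needs no approximation from \<open>E\<close>: quasidensity is applied at the centre \<open>(0, u - w)\<close>,
  where \<open>w\<close> nearly minimizes \<open>\<parallel>w\<parallel>\<^sup>2 / 2 + Y w\<close>, and the terms containing \<open>w\<close> and \<open>Y\<close> are absorbed by the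
  squares in \<open>r_L\<close>.
\<close>

lemma quasidense_conjugate_above_bidual_q:
  fixes A :: "(('a::real_normed_vector \<times> 'a dual) \<times> real) set"
  assumes D: "quasidense D" and DA: "\<And>b. b \<in> D \<Longrightarrow> (b, q_L b) \<in> A"
  shows "conjugate_above_bidual_q A"
  unfolding conjugate_above_bidual_q_def
proof (intro allI impI)
  fix u :: "'a dual" and Y :: "'a dual \<Rightarrow>\<^sub>L real" and \<epsilon> :: real
  assume \<epsilon>: "0 < \<epsilon>"
  then obtain w where w: "(norm w)\<^sup>2 / 2 + Y w \<le> - (norm Y)\<^sup>2 / 2 + \<epsilon> / 2"
    using exists_almost_dual_vector[of "\<epsilon> / 2" Y] by auto
  have "0 < \<epsilon> / 2" using \<epsilon> by simp
  then obtain b where b: "b \<in> D" "r_L (b - (0, u - w)) < \<epsilon> / 2"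
    using D unfolding quasidense_iff_r_L by blast
  obtain s s' where bs: "b = (s, s')" by (cases b)
  define t where "t = s' - u"
  have "r_L (s, t + w) < \<epsilon> / 2"
    using b(2) by (simp add: bs t_def algebra_simps)
  then have small: "(norm s)\<^sup>2 / 2 + (norm (t + w))\<^sup>2 / 2 + (t s + w s) < \<epsilon> / 2"
    by (simp add: r_L_def q_L_def norm_Pair blinfun.add_left add_divide_distrib)
  have "- Y (t + w) \<le> (norm Y)\<^sup>2 / 2 + (norm (t + w))\<^sup>2 / 2"
    "- w s \<le> (norm w)\<^sup>2 / 2 + (norm s)\<^sup>2 / 2"
    by (rule neg_blinfun_le_half_squares)+
  then have "t s - Y t \<le> \<epsilon>"
    using small w by (simp add: blinfun.add_right)
  then have "Y u - \<epsilon> \<le> u s + Y s' - q_L (s, s')"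
    by (simp add: t_def q_L_def blinfun.diff_left blinfun.diff_right)
  then show "\<exists>x \<xi> r. ((x, \<xi>), r) \<in> A \<and> blinfun_apply Y u - \<epsilon> \<le> blinfun_apply u x + blinfun_apply Y \<xi> - r"
    using DA[OF b(1)] bs by blast
qed

section \<open>Epigraphs and the partial episum\<close>

definition epi :: "('b \<Rightarrow> ereal) \<Rightarrow> ('b \<times> real) set" where
  "epi k = {(b, r). k b \<le> ereal r}"

lemma closed_epi:
  fixes k :: "'b::metric_space \<Rightarrow> ereal"
  assumes "lower_semicontinuous k"
  shows "closed (epi k)"
  unfolding closed_sequential_limits
proof (intro allI impI, elim conjE)
  fix p l assume p: "\<forall>n. p n \<in> epi k" "p \<longlonglongrightarrow> l"
  have fst: "(\<lambda>n. fst (p n)) \<longlonglongrightarrow> fst l" and snd: "(\<lambda>n. snd (p n)) \<longlonglongrightarrow> snd l"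
    using p(2) by (auto intro: tendsto_fst tendsto_snd)
  have "k (fst l) \<le> ereal (snd l)"
  proof (rule ccontr)
    assume "\<not> ?thesis"
    then obtain c where c: "ereal (snd l) < ereal c" "ereal c < k (fst l)"
      using ereal_dense2[of "ereal (snd l)" "k (fst l)"] by (auto simp: not_le)
    have "\<forall>\<^sub>F n in sequentially. ereal c < k (fst (p n))"
      using assms c(2) fst unfolding lower_semicontinuous_def filterlim_def le_filter_def
      by (force simp: eventually_filtermap)
    moreover have "\<forall>\<^sub>F n in sequentially. snd (p n) < c"
      using order_tendstoD(2)[OF snd, of c] c(1) by simp
    ultimately have "\<forall>\<^sub>F n in sequentially. False"
    proof eventually_elim
      case (elim n)
      then show ?case
        using p(1) by (auto simp: epi_def split_beta dest!: spec[of _ n]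
            dest: order.strict_trans1 order_less_trans less_le_trans)
    qed
    then show False by simp
  qed
  then show "l \<in> epi k" by (simp add: epi_def split_beta)
qed

lemma convex_epi:
  assumes k: "convex_fun k"
  shows "convex (epi k)"
proof (rule convexI)
  fix p p' and u v :: real
  assume p: "p \<in> epi k" "p' \<in> epi k" and uv: "0 \<le> u" "0 \<le> v" "u + v = 1"
  show "u *\<^sub>R p + v *\<^sub>R p' \<in> epi k"
  proof (cases "u = 0 \<or> v = 0")
    case True
    then show ?thesis using p uv by auto
  next
    case False
    then have v: "0 < v" "v < 1" and u: "u = 1 - v" "0 < u" using uv by auto
    have le: "k (fst p) \<le> ereal (snd p)" "k (fst p') \<le> ereal (snd p')"
      using p by (auto simp: epi_def)
    have "k (u *\<^sub>R fst p + v *\<^sub>R fst p') \<le> ereal u * k (fst p) + ereal v * k (fst p')"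
      using k v u unfolding convex_fun_def by blast
    also have "\<dots> \<le> ereal u * ereal (snd p) + ereal v * ereal (snd p')"
      using u v le by (intro add_mono ereal_mult_left_mono) auto
    finally show ?thesis by (simp add: epi_def split_beta)
  qed
qed

lemma fst_edom_eq:
  assumes "\<forall>b. k b \<noteq> -\<infinity>"
  shows "fst ` edom k = fst ` fst ` epi k"
proof -
  have "edom k = fst ` epi k"
  proof (intro equalityI subsetI)
    fix b assume "b \<in> edom k"
    then obtain r where "k b = ereal r" by (cases "k b") (auto simp: edom_def)
    then show "b \<in> fst ` epi k" by (force simp: epi_def)
  next
    fix b assume "b \<in> fst ` epi k"
    then show "b \<in> edom k" using assms by (cases "k b") (auto simp: epi_def edom_def)
  qed
  then show ?thesis by simp
qed

text \<open>
  For epigraphs \<open>A\<close> of \<open>f\<close> and \<open>B\<close> of \<open>g\<close>, both avoiding \<open>-\<infinity>\<close>, this lies between the strict epigraph and the epigraph of \<open>f \<oplus>\<^sub>2 g\<close>; a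
  boundary point belongs to it only when the infimum is attained.
\<close>

definition fibre_sum :: "(('a::real_normed_vector \<times> 'a dual) \<times> real) set
    \<Rightarrow> (('a \<times> 'a dual) \<times> real) set \<Rightarrow> (('a \<times> 'a dual) \<times> real) set" where
  "fibre_sum A B = {((x, \<xi> + \<eta>), r + s) | x \<xi> \<eta> r s. ((x, \<xi>), r) \<in> A \<and> ((x, \<eta>), s) \<in> B}"

lemma convex_fibre_sum:
  assumes A: "convex A" and B: "convex B"
  shows "convex (fibre_sum A B)"
proof (rule convexI)
  fix p p' and u v :: real
  assume p: "p \<in> fibre_sum A B" "p' \<in> fibre_sum A B" and uv: "0 \<le> u" "0 \<le> v" "u + v = 1"
  from p obtain x \<xi> \<eta> r s x' \<xi>' \<eta>' r' s' where
    mem: "((x, \<xi>), r) \<in> A" "((x, \<eta>), s) \<in> B" "((x', \<xi>'), r') \<in> A" "((x', \<eta>'), s') \<in> B"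
    and p_eq: "p = ((x, \<xi> + \<eta>), r + s)" "p' = ((x', \<xi>' + \<eta>'), r' + s')"
    by (auto simp: fibre_sum_def)
  have "((u *\<^sub>R x + v *\<^sub>R x', u *\<^sub>R \<xi> + v *\<^sub>R \<xi>'), u * r + v * r') \<in> A"
    using convexD[OF A mem(1,3) uv] by simp
  moreover have "((u *\<^sub>R x + v *\<^sub>R x', u *\<^sub>R \<eta> + v *\<^sub>R \<eta>'), u * s + v * s') \<in> B"
    using convexD[OF B mem(2,4) uv] by simp
  moreover have "u *\<^sub>R p + v *\<^sub>R p' =
      ((u *\<^sub>R x + v *\<^sub>R x', (u *\<^sub>R \<xi> + v *\<^sub>R \<xi>') + (u *\<^sub>R \<eta> + v *\<^sub>R \<eta>')), (u * r + v * r') + (u * s + v * s'))"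
    by (simp add: p_eq algebra_simps)
  ultimately show "u *\<^sub>R p + v *\<^sub>R p' \<in> fibre_sum A B"
    unfolding fibre_sum_def by blast
qed

lemma above_q_fibre_sum:
  assumes "above_q A" "above_q B"
  shows "above_q (fibre_sum A B)"
proof -
  have "q_L (x, \<xi> + \<eta>) \<le> r + s" if "((x, \<xi>), r) \<in> A" "((x, \<eta>), s) \<in> B" for x \<xi> \<eta> r s
    using above_qD[OF assms(1) that(1)] above_qD[OF assms(2) that(2)]
    by (simp add: q_L_def blinfun.add_left)
  then show ?thesis by (auto simp: above_q_def fibre_sum_def)
qed

definition diff_cone :: "(('a::real_vector \<times> 'c) \<times> real) set \<Rightarrow> (('a \<times> 'd) \<times> real) set \<Rightarrow> 'a set" where
  "diff_cone A B = (\<Union>l\<in>{0::real<..}. (*\<^sub>R) l ` {x - y | x y. x \<in> fst ` fst ` A \<and> y \<in> fst ` fst ` B})"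

text \<open>
  The hypothesis says that \<open>k b\<close> is the infimum of the numbers paired with \<open>b\<close> in \<open>W\<close>, which holds for both an
  epigraph and a fibre sum of epigraphs.
\<close>

lemma at_conjugate_le_iff:
  assumes W: "\<And>b t. ereal t \<le> k b \<longleftrightarrow> (\<forall>r. (b, r) \<in> W \<longrightarrow> t \<le> r)"
  shows "at_conjugate k c \<le> ereal t \<longleftrightarrow> (\<forall>(b, r)\<in>W. pairing b c - r \<le> t)"
proof -
  have *: "ereal p - k b \<le> ereal t \<longleftrightarrow> ereal (p - t) \<le> k b" for p b
    by (cases "k b") auto
  have "at_conjugate k c = (SUP b. ereal (pairing b c) - k b)"
    by (simp add: at_conjugate_def pairing_def split_beta)
  then have "at_conjugate k c \<le> ereal t \<longleftrightarrow> (\<forall>b. ereal (pairing b c - t) \<le> k b)"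
    by (simp only: SUP_le_iff * ball_UNIV)
  also have "\<dots> \<longleftrightarrow> (\<forall>(b, r)\<in>W. pairing b c - r \<le> t)"
    unfolding W by (force simp: algebra_simps)
  finally show ?thesis .
qed

lemma ereal_le_iff_epi: "ereal t \<le> k b \<longleftrightarrow> (\<forall>r. (b, r) \<in> epi k \<longrightarrow> t \<le> r)"
  by (cases "k b") (auto simp: epi_def not_le intro: lt_ex)

lemma ereal_le_partial_episum_iff:
  assumes "\<forall>b. f b \<noteq> -\<infinity>" "\<forall>b. g b \<noteq> -\<infinity>"
  shows "ereal t \<le> (f \<oplus>\<^sub>2 g) b \<longleftrightarrow> (\<forall>r. (b, r) \<in> fibre_sum (epi f) (epi g) \<longrightarrow> t \<le> r)"
proof (cases b)
  case (Pair x x')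
  have *: "ereal t \<le> p + q \<longleftrightarrow> (\<forall>r s. p \<le> ereal r \<longrightarrow> q \<le> ereal s \<longrightarrow> t \<le> r + s)"
    if "p \<noteq> -\<infinity>" "q \<noteq> -\<infinity>" for p q
    using that by (cases p; cases q) (auto intro: add_mono order_trans)
  have "ereal t \<le> (f \<oplus>\<^sub>2 g) b \<longleftrightarrow> (\<forall>\<eta>. ereal t \<le> f (x, x' - \<eta>) + g (x, \<eta>))"
    by (simp add: Pair partial_episum_def le_INF_iff)
  also have "\<dots> \<longleftrightarrow> (\<forall>\<eta> r s. f (x, x' - \<eta>) \<le> ereal r \<longrightarrow> g (x, \<eta>) \<le> ereal s \<longrightarrow> t \<le> r + s)"
    using assms by (simp add: *)
  also have "\<dots> \<longleftrightarrow> (\<forall>r. (b, r) \<in> fibre_sum (epi f) (epi g) \<longrightarrow> t \<le> r)"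
    unfolding fibre_sum_def epi_def Pair
    by (auto, metis add_diff_cancel_right', metis diff_add_cancel)
  finally show ?thesis .
qed

section \<open>Duality for the partial episum\<close>

lemma bounded_linear_fst_o: "bounded_linear f \<Longrightarrow> bounded_linear (\<lambda>x. fst (f x))"
  by (rule bounded_linear_compose[OF bounded_linear_fst])

lemma bounded_linear_snd_o: "bounded_linear f \<Longrightarrow> bounded_linear (\<lambda>x. snd (f x))"
  by (rule bounded_linear_compose[OF bounded_linear_snd])

lemmas bounded_linear_prod_intros = bounded_linear_fst_o bounded_linear_snd_o bounded_linear_ident
  bounded_linear_Pair bounded_linear_add bounded_linear_sub

text \<open>
  The multiplier of the constraint \<open>x = x'\<close>, for \<open>((x, \<xi>), r)\<close> in \<open>A\<close> and \<open>((x', \<eta>), s)\<close> in \<open>B\<close>, is the part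
  of \<open>y'\<close> assigned to \<open>B\<close>.
\<close>

lemma conjugate_fibre_sum_split:
  fixes A B :: "(('a::banach \<times> 'a dual) \<times> real) set"
  assumes A: "closed A" "convex A" and B: "closed B" "convex B"
    and S: "subspace (diff_cone A B)" "closed (diff_cone A B)"
    and le: "\<And>b r. (b, r) \<in> fibre_sum A B \<Longrightarrow> pairing b (y, y') - r \<le> t"
  obtains v where "\<And>b r d s. (b, r) \<in> A \<Longrightarrow> (d, s) \<in> B \<Longrightarrow>
    (pairing b (y, y' - v) - r) + (pairing d (y, v) - s) \<le> t"
proof -
  define T where "T z = fst (fst (fst z)) - fst (fst (snd z))"
    for z :: "(('a \<times> 'a dual) \<times> real) \<times> (('a \<times> 'a dual) \<times> real)"
  define \<rho> where "\<rho> z = snd (fst z) + snd (snd z)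
      - (pairing (fst (fst z)) (y, y') + blinfun_apply (snd (fst (snd z))) y)"
    for z :: "(('a \<times> 'a dual) \<times> real) \<times> (('a \<times> 'a dual) \<times> real)"
  have T: "bounded_linear T"
    unfolding T_def by (intro bounded_linear_prod_intros)
  have \<rho>: "bounded_linear \<rho>"
    unfolding \<rho>_def
    by (intro bounded_linear_prod_intros bounded_linear_compose[OF bounded_linear_pairing]
        bounded_linear_compose[OF blinfun.bounded_linear_left])
  have "T ` (A \<times> B) = {x - y | x y. x \<in> fst ` fst ` A \<and> y \<in> fst ` fst ` B}"
    by (force simp: T_def)
  then have F: "diff_cone A B = (\<Union>l\<in>{0<..}. (*\<^sub>R) l ` T ` (A \<times> B))"
    by (simp add: diff_cone_def)
  have "- t \<le> \<rho> z" if "z \<in> A \<times> B" "T z = 0" for z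
  proof -
    obtain x \<xi> r x' \<eta> s where z: "z = (((x, \<xi>), r), ((x', \<eta>), s))"
      by (metis prod.collapse)
    have "((x, \<xi> + \<eta>), r + s) \<in> fibre_sum A B"
      using that by (auto simp: z T_def fibre_sum_def)
    from le[OF this] show ?thesis
      by (simp add: z \<rho>_def pairing_def blinfun.add_left)
  qed
  then obtain u where u: "bounded_linear u" "\<And>z. z \<in> A \<times> B \<Longrightarrow> - t \<le> \<rho> z + u (T z)"
    using Lagrange_multiplier[OF T \<rho> _ _ F S] A B closed_Times convex_Times by metis
  define v where "v = Blinfun u"
  have v: "blinfun_apply v = u"
    using u(1) by (simp add: v_def bounded_linear_Blinfun_apply)
  show thesis
  proof
    fix b r d s assume mem: "(b, r) \<in> A" "(d, s) \<in> B"
    from u(2)[of "((b, r), (d, s))"] mem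
    have "- t \<le> r + s - (pairing b (y, y') + blinfun_apply (snd d) y) + blinfun_apply v (fst b - fst d)"
      by (simp add: \<rho>_def T_def v)
    then show "(pairing b (y, y' - v) - r) + (pairing d (y, v) - s) \<le> t"
      by (simp add: pairing_def blinfun.diff_left blinfun.diff_right)
  qed
qed

lemma closed_half_square_epigraph:
  fixes c :: "'b::real_normed_vector"
  shows "closed {(b, t). (norm (b - c))\<^sup>2 / 2 \<le> t}"
proof -
  have "closed {p. (norm (fst p - c))\<^sup>2 / 2 \<le> snd p}"
    by (intro closed_Collect_le continuous_intros) auto
  then show ?thesis by (simp only: case_prod_unfold)
qed

lemma convex_half_square_epigraph:
  fixes c :: "'b::real_normed_vector"
  shows "convex {(b, t). (norm (b - c))\<^sup>2 / 2 \<le> t}"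
proof (rule convexI)
  fix p p' :: "'b \<times> real" and u v :: real
  assume p: "p \<in> {(b, t). (norm (b - c))\<^sup>2 / 2 \<le> t}" "p' \<in> {(b, t). (norm (b - c))\<^sup>2 / 2 \<le> t}"
    and uv: "0 \<le> u" "0 \<le> v" "u + v = 1"
  define a a' where "a = norm (fst p - c)" and "a' = norm (fst p' - c)"
  have v_eq: "v = 1 - u" using uv by simp
  have "norm (u *\<^sub>R fst p + v *\<^sub>R fst p' - c) = norm (u *\<^sub>R (fst p - c) + v *\<^sub>R (fst p' - c))"
    by (simp add: v_eq algebra_simps)
  also have "\<dots> \<le> u * a + v * a'"
    using norm_triangle_ineq[of "u *\<^sub>R (fst p - c)" "v *\<^sub>R (fst p' - c)"] uv by (simp add: a_def a'_def)
  finally have "(norm (u *\<^sub>R fst p + v *\<^sub>R fst p' - c))\<^sup>2 \<le> (u * a + v * a')\<^sup>2"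
    by (intro power_mono) auto
  also have "\<dots> = u * a\<^sup>2 + v * a'\<^sup>2 - u * v * (a - a')\<^sup>2"
    by (simp add: v_eq power2_eq_square algebra_simps)
  also have "\<dots> \<le> u * a\<^sup>2 + v * a'\<^sup>2"
    using uv by simp
  also have "\<dots> \<le> u * (2 * snd p) + v * (2 * snd p')"
    using p uv by (intro add_mono mult_left_mono) (auto simp: a_def a'_def)
  finally show "u *\<^sub>R p + v *\<^sub>R p' \<in> {(b, t). (norm (b - c))\<^sup>2 / 2 \<le> t}"
    by (simp add: split_beta)
qed

text \<open>
  The variables are points of \<open>A\<close> and \<open>B\<close> and an independent copy \<open>b\<close> of the argument of the squared norm, subject to
  \<open>x = x'\<close> and \<open>b = (x, \<xi> + \<eta>)\<close>. The second constraint is solvable for every right-hand side, so the closed subspace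
  condition concerns \<open>x - x'\<close> only. The multiplier \<open>u\<close> of the first constraint splits the \<open>E\<^sup>*\<close> part \<open>v\<close> of the
  other multiplier into \<open>v - u\<close> for \<open>A\<close> and \<open>u\<close> for \<open>B\<close>. With the bidual inequalities for \<open>A\<close> and \<open>B\<close>
  the contradiction reduces to \<open>- e2 e1 \<le> \<parallel>e1\<parallel>\<^sup>2 / 2 + \<parallel>e2\<parallel>\<^sup>2 / 2\<close>, where \<open>(e1, e2)\<close> is \<open>(v, Y)\<close> minus the
  functional \<open>pairing \<cdot> c\<close>.
\<close>

lemma nearly_touching_fibre_sum:
  fixes A B :: "(('a::banach \<times> 'a dual) \<times> real) set"
  assumes A: "closed A" "convex A" "conjugate_above_bidual_q A"
    and B: "closed B" "convex B" "conjugate_above_bidual_q B"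
    and S: "subspace (diff_cone A B)" "closed (diff_cone A B)"
  shows "nearly_touching (fibre_sum A B)"
proof (rule ccontr)
  assume "\<not> ?thesis"
  then obtain c e where e: "0 < e"
    and none: "\<not> (\<exists>(b, r)\<in>fibre_sum A B. r - q_L b + r_L (b - c) < e)"
    unfolding nearly_touching_def by meson
  have far: "e \<le> r - q_L b + r_L (b - c)" if "(b, r) \<in> fibre_sum A B" for b r
    using none that by (force simp: not_less)
  define N where "N = {(b :: 'a \<times> 'a dual, t). (norm (b - c))\<^sup>2 / 2 \<le> t}"
  define G where "G = (A \<times> B) \<times> N"
  define T where "T z = (fst (fst (fst (fst z))) - fst (fst (snd (fst z))),
      fst (snd z) - (fst (fst (fst (fst z))), snd (fst (fst (fst z))) + snd (fst (snd (fst z)))))"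
    for z :: "((('a \<times> 'a dual) \<times> real) \<times> (('a \<times> 'a dual) \<times> real)) \<times> (('a \<times> 'a dual) \<times> real)"
  define \<rho> where "\<rho> z = snd (fst (fst z)) + snd (snd (fst z)) + snd (snd z) - pairing (fst (snd z)) c"
    for z :: "((('a \<times> 'a dual) \<times> real) \<times> (('a \<times> 'a dual) \<times> real)) \<times> (('a \<times> 'a dual) \<times> real)"
  have T: "bounded_linear T"
    unfolding T_def by (intro bounded_linear_prod_intros)
  have \<rho>: "bounded_linear \<rho>"
    unfolding \<rho>_def
    by (intro bounded_linear_prod_intros bounded_linear_compose[OF bounded_linear_pairing])
  have G: "closed G" "convex G"
    unfolding G_def N_def using A B
    by (auto intro!: closed_Times convex_Times closed_half_square_epigraph convex_half_square_epigraph)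
  have F: "diff_cone A B \<times> UNIV = (\<Union>l\<in>{0<..}. (*\<^sub>R) l ` T ` G)"
  proof (intro equalityI subsetI)
    fix p assume "p \<in> diff_cone A B \<times> (UNIV :: ('a \<times> 'a dual) set)"
    then obtain l x \<xi> r x' \<eta> s w b where mem: "0 < l" "((x, \<xi>), r) \<in> A" "((x', \<eta>), s) \<in> B"
      and p: "p = (l *\<^sub>R (x - x'), b)"
      by (cases p) (auto simp: diff_cone_def)
    \<comment> \<open>\<open>T\<close> maps the triple with third component \<open>b'\<close> to \<open>p / l\<close>\<close>
    define b' where "b' = (1 / l) *\<^sub>R b + (x, \<xi> + \<eta>)"
    define z where "z = ((((x, \<xi>), r), ((x', \<eta>), s)), (b', (norm (b' - c))\<^sup>2 / 2))"
    have "z \<in> G" using mem by (simp add: z_def G_def N_def)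
    moreover have "p = l *\<^sub>R T z"
      using mem by (simp add: p z_def T_def b'_def)
    ultimately show "p \<in> (\<Union>l\<in>{0<..}. (*\<^sub>R) l ` T ` G)"
      using mem by blast
  next
    fix p assume "p \<in> (\<Union>l\<in>{0<..}. (*\<^sub>R) l ` T ` G)"
    then obtain l x \<xi> r x' \<eta> s b t where l: "0 < l" and mem: "((x, \<xi>), r) \<in> A" "((x', \<eta>), s) \<in> B"
      and p: "p = l *\<^sub>R T ((((x, \<xi>), r), ((x', \<eta>), s)), (b, t))"
      by (auto simp: G_def)
    have "x - x' \<in> {x - y | x y. x \<in> fst ` fst ` A \<and> y \<in> fst ` fst ` B}"
      using mem by force
    then have "l *\<^sub>R (x - x') \<in> diff_cone A B"
      using l unfolding diff_cone_def by blast
    then show "p \<in> diff_cone A B \<times> UNIV"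
      by (simp add: p T_def)
  qed
  have F': "subspace (diff_cone A B \<times> (UNIV :: ('a \<times> 'a dual) set))"
    "closed (diff_cone A B \<times> (UNIV :: ('a \<times> 'a dual) set))"
    using S by (auto intro: subspace_Times closed_Times)
  have "e - q_L c \<le> \<rho> z" if z: "z \<in> G" and T0: "T z = 0" for z
  proof -
    obtain x \<xi> r x' \<eta> s b t where z_eq: "z = ((((x, \<xi>), r), ((x', \<eta>), s)), (b, t))"
      by (metis prod.collapse)
    have "fst (T z) = 0" "snd (T z) = 0" using T0 by simp_all
    then have "x = x'" and b: "b = (x, \<xi> + \<eta>)"
      by (simp_all add: z_eq T_def)
    then have "(b, r + s) \<in> fibre_sum A B"
      using z by (auto simp: z_eq G_def fibre_sum_def)
    from far[OF this] have "e \<le> r + s - pairing b c + q_L c + (norm (b - c))\<^sup>2 / 2"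
      by (simp add: r_L_def q_L_diff)
    moreover have "(norm (b - c))\<^sup>2 / 2 \<le> t"
      using z by (simp add: z_eq G_def N_def)
    ultimately show ?thesis by (simp add: z_eq \<rho>_def)
  qed
  then obtain U where U: "bounded_linear U" "\<And>z. z \<in> G \<Longrightarrow> e - q_L c \<le> \<rho> z + U (T z)"
    using Lagrange_multiplier[OF T \<rho> G F F'] by metis
  interpret U: bounded_linear U by (rule U(1))
  define u where "u = Blinfun (\<lambda>x. U (x, 0))"
  define v where "v = Blinfun (\<lambda>x. U (0, (x, 0)))"
  define Y where "Y = Blinfun (\<lambda>\<xi>. U (0, (0, \<xi>)))"
  have app: "blinfun_apply u = (\<lambda>x. U (x, 0))" "blinfun_apply v = (\<lambda>x. U (0, (x, 0)))"
    "blinfun_apply Y = (\<lambda>\<xi>. U (0, (0, \<xi>)))"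
    unfolding u_def v_def Y_def
    by (intro bounded_linear_Blinfun_apply bounded_linear_compose[OF U(1)] bounded_linear_prod_intros
        bounded_linear_zero)+
  have U_split: "U (w, (a, \<alpha>)) = blinfun_apply u w + blinfun_apply v a + blinfun_apply Y \<alpha>" for w a \<alpha>
  proof -
    have "(w, (a, \<alpha>)) = (w, 0) + (0, (a, 0)) + (0, (0, \<alpha>))"
      by (simp add: zero_prod_def)
    then show ?thesis by (simp only: app U.add)
  qed
  obtain c1 c2 where c: "c = (c1, c2)" by (cases c)
  define e1 where "e1 = v - c2"
  define e2 where "e2 = Y - Blinfun (\<lambda>\<xi>. blinfun_apply \<xi> c1)"
  have eval: "blinfun_apply (Blinfun (\<lambda>\<xi>. blinfun_apply \<xi> c1)) \<xi> = blinfun_apply \<xi> c1" for \<xi> :: "'a dual"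
    by (simp add: bounded_linear_Blinfun_apply blinfun.bounded_linear_left)
  have e8: "0 < e / 8" using e by simp
  obtain d1 where d1: "(norm d1)\<^sup>2 / 2 + blinfun_apply e1 d1 \<le> - (norm e1)\<^sup>2 / 2 + e / 8"
    using exists_almost_dual_vector[OF e8] by blast
  obtain d2 where d2: "(norm d2)\<^sup>2 / 2 + blinfun_apply e2 d2 \<le> - (norm e2)\<^sup>2 / 2 + e / 8"
    using exists_almost_dual_vector[OF e8] by blast
  obtain x \<xi> r where a: "((x, \<xi>), r) \<in> A"
    "blinfun_apply Y (v - u) - e / 8 \<le> blinfun_apply (v - u) x + blinfun_apply Y \<xi> - r"
    using A(3) e8 unfolding conjugate_above_bidual_q_def by blast
  obtain x' \<eta> s where b: "((x', \<eta>), s) \<in> B"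
    "blinfun_apply Y u - e / 8 \<le> blinfun_apply u x' + blinfun_apply Y \<eta> - s"
    using B(3) e8 unfolding conjugate_above_bidual_q_def by blast
  define d where "d = (d1, d2)"
  define z where "z = ((((x, \<xi>), r), ((x', \<eta>), s)), (c + d, (norm d)\<^sup>2 / 2))"
  have "z \<in> G" using a b by (simp add: z_def G_def N_def)
  from U(2)[OF this]
  have main: "e - q_L c \<le> r + s + (norm d)\<^sup>2 / 2 - pairing (c + d) c
      + (blinfun_apply u (x - x') + blinfun_apply v (c1 + d1 - x) + blinfun_apply Y (c2 + d2 - (\<xi> + \<eta>)))"
    by (simp add: z_def \<rho>_def T_def c d_def U_split)
  have nd: "(norm d)\<^sup>2 / 2 = (norm d1)\<^sup>2 / 2 + (norm d2)\<^sup>2 / 2"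
    by (simp add: d_def norm_Pair add_divide_distrib)
  have pd: "pairing (c + d) c = 2 * blinfun_apply c2 c1 + blinfun_apply c2 d1 + blinfun_apply d2 c1"
    by (simp add: pairing_def c d_def blinfun.add_left blinfun.add_right)
  have e1_app: "blinfun_apply e1 w = blinfun_apply v w - blinfun_apply c2 w" for w
    by (simp add: e1_def blinfun.diff_left)
  have e2_app: "blinfun_apply e2 w = blinfun_apply Y w - blinfun_apply w c1" for w
    by (simp add: e2_def blinfun.diff_left eval)
  have "blinfun_apply e2 e1 = blinfun_apply Y v - blinfun_apply Y c2
      - blinfun_apply v c1 + blinfun_apply c2 c1"
    by (simp add: e2_app e1_def blinfun.diff_left blinfun.diff_right)
  with neg_blinfun_le_half_squares[of e2 e1]
  have ee: "- (blinfun_apply Y v - blinfun_apply Y c2 - blinfun_apply v c1 + blinfun_apply c2 c1)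
      \<le> (norm e2)\<^sup>2 / 2 + (norm e1)\<^sup>2 / 2"
    by simp
  have qc: "q_L c = blinfun_apply c2 c1" by (simp add: c q_L_def)
  show False
    using main d1 d2 a(2) b(2) ee e
    unfolding nd pd qc e1_app e2_app blinfun.diff_left blinfun.diff_right blinfun.add_right
    by argo
qed

theorem theorem5p2:
  fixes f g :: "'a::banach \<times> 'a dual \<Rightarrow> ereal"
  assumes nonzero: "\<exists>x::'a. x \<noteq> 0"
    and f_range: "\<forall>b. f b \<noteq> -\<infinity>" and g_range: "\<forall>b. g b \<noteq> -\<infinity>"
    and f_proper: "proper_fun f" and g_proper: "proper_fun g"
    and f_convex: "convex_fun f" and g_convex: "convex_fun g"
    and f_lsc: "lower_semicontinuous f" and g_lsc: "lower_semicontinuous g"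
    and f_ge: "\<forall>b. f b \<ge> ereal (q_L b)" and g_ge: "\<forall>b. g b \<ge> ereal (q_L b)"
    and subspace: "subspace (\<Union>l\<in>{0::real<..}. (*\<^sub>R) l ` {x - y | x y. x \<in> fst ` edom f \<and> y \<in> fst ` edom g})"
    and closed_subspace: "closed (\<Union>l\<in>{0::real<..}. (*\<^sub>R) l ` {x - y | x y. x \<in> fst ` edom f \<and> y \<in> fst ` edom g})"
    and f_qd: "quasidense (coinc f)" and g_qd: "quasidense (coinc g)"
  shows "(\<forall>b. at_conjugate (f \<oplus>\<^sub>2 g) b \<ge> ereal (q_L b))
    \<and> closed (coinc (at_conjugate (f \<oplus>\<^sub>2 g)))
    \<and> quasidense (coinc (at_conjugate (f \<oplus>\<^sub>2 g)))
    \<and> (\<forall>y y'. (y, y') \<in> coinc (at_conjugate (f \<oplus>\<^sub>2 g)) \<longleftrightarrow>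
         (\<exists>u v. (y, u) \<in> coinc (at_conjugate f) \<and> (y, v) \<in> coinc (at_conjugate g) \<and> u + v = y'))"
proof -
  let ?A = "epi f" and ?B = "epi g" and ?h = "f \<oplus>\<^sub>2 g"
  have S: "subspace (diff_cone ?A ?B)" "closed (diff_cone ?A ?B)"
    using subspace closed_subspace fst_edom_eq[OF f_range] fst_edom_eq[OF g_range]
    by (simp_all add: diff_cone_def)
  have above: "above_q (epi k)" if "\<forall>b. k b \<ge> ereal (q_L b)" for k :: "'a \<times> 'a dual \<Rightarrow> ereal"
  proof -
    have "q_L b \<le> r" if "k b \<le> ereal r" for b r
      using order_trans[OF spec[OF \<open>\<forall>b. k b \<ge> ereal (q_L b)\<close>] that] by simp
    then show ?thesis by (auto simp: above_q_def epi_def)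
  qed
  have coinc_epi: "(b, q_L b) \<in> epi k" if "b \<in> coinc k" for b and k :: "'a \<times> 'a dual \<Rightarrow> ereal"
    using that by (auto simp: coinc_def epi_def)
  have nearly: "nearly_touching (epi k)" if qd: "quasidense (coinc k)" for k :: "'a \<times> 'a dual \<Rightarrow> ereal"
    unfolding nearly_touching_def
  proof (intro allI impI)
    fix c and e :: real assume "0 < e"
    then obtain b where "b \<in> coinc k" "r_L (b - c) < e"
      using qd unfolding quasidense_iff_r_L by blast
    then show "\<exists>(b, r)\<in>epi k. r - q_L b + r_L (b - c) < e"
      using coinc_epi by (intro bexI[of _ "(b, q_L b)"]) auto
  qed
  note conj_le = at_conjugate_le_iff[of _ "epi _", OF ereal_le_iff_epi]
  note f_conj_ge = coinc_conjugate_of_nearly_touching(1)[OF convex_epi[OF f_convex] above[OF f_ge]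
      nearly[OF f_qd] conj_le]
  note g_conj_ge = coinc_conjugate_of_nearly_touching(1)[OF convex_epi[OF g_convex] above[OF g_ge]
      nearly[OF g_qd] conj_le]
  note h_conj_le = at_conjugate_le_iff[of ?h "fibre_sum ?A ?B", OF ereal_le_partial_episum_iff[OF f_range g_range]]
  have nearly_sum: "nearly_touching (fibre_sum ?A ?B)"
    using f_qd g_qd f_lsc g_lsc f_convex g_convex S
    by (intro nearly_touching_fibre_sum closed_epi convex_epi)
      (auto intro: quasidense_conjugate_above_bidual_q coinc_epi)
  note h = coinc_conjugate_of_nearly_touching[OF
      convex_fibre_sum[OF convex_epi[OF f_convex] convex_epi[OF g_convex]]
      above_q_fibre_sum[OF above[OF f_ge] above[OF g_ge]] nearly_sum h_conj_le]
  have coincI: "b \<in> coinc k" if "ereal (q_L b) \<le> k b" "k b \<le> ereal (q_L b)"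
    for b and k :: "'a \<times> 'a dual \<Rightarrow> ereal"
    using that by (simp add: coinc_def)
  have coincD: "k b \<le> ereal (q_L b)" if "b \<in> coinc k" for b and k :: "'a \<times> 'a dual \<Rightarrow> ereal"
    using that by (simp add: coinc_def)
  have "(y, y') \<in> coinc (at_conjugate ?h) \<longleftrightarrow>
      (\<exists>u v. (y, u) \<in> coinc (at_conjugate f) \<and> (y, v) \<in> coinc (at_conjugate g) \<and> u + v = y')" for y y'
  proof
    assume "(y, y') \<in> coinc (at_conjugate ?h)"
    then have "\<And>b r. (b, r) \<in> fibre_sum ?A ?B \<Longrightarrow> pairing b (y, y') - r \<le> q_L (y, y')"
      using coincD h_conj_le by blast
    then obtain v where v: "\<And>b r d s. (b, r) \<in> ?A \<Longrightarrow> (d, s) \<in> ?B \<Longrightarrow>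
        (pairing b (y, y' - v) - r) + (pairing d (y, v) - s) \<le> q_L (y, y')"
      using conjugate_fibre_sum_split[OF closed_epi[OF f_lsc] convex_epi[OF f_convex]
          closed_epi[OF g_lsc] convex_epi[OF g_convex] S] by metis
    have q: "q_L (y, y') = q_L (y, y' - v) + q_L (y, v)"
      by (simp add: q_L_def blinfun.diff_left)
    have "at_conjugate f (y, y' - v) \<le> ereal (q_L (y, y' - v))"
      unfolding conj_le
    proof (intro ballI, clarify)
      fix x x' r assume b: "((x, x'), r) \<in> ?A"
      \<comment> \<open>the supremum over the second point is at least \<open>q_L (y, v)\<close>, which isolates the first\<close>
      have "at_conjugate g (y, v) \<le> ereal (q_L (y, y') - (pairing (x, x') (y, y' - v) - r))"
        unfolding conj_le using v[OF b] by (force simp: algebra_simps)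
      with g_conj_ge have "q_L (y, v) \<le> q_L (y, y') - (pairing (x, x') (y, y' - v) - r)"
        using order_trans by fastforce
      then show "pairing (x, x') (y, y' - v) - r \<le> q_L (y, y' - v)"
        using q by simp
    qed
    moreover have "at_conjugate g (y, v) \<le> ereal (q_L (y, v))"
      unfolding conj_le
    proof (intro ballI, clarify)
      fix x x' s assume d: "((x, x'), s) \<in> ?B"
      have "at_conjugate f (y, y' - v) \<le> ereal (q_L (y, y') - (pairing (x, x') (y, v) - s))"
        unfolding conj_le using v[OF _ d] by (force simp: algebra_simps)
      with f_conj_ge have "q_L (y, y' - v) \<le> q_L (y, y') - (pairing (x, x') (y, v) - s)"
        using order_trans by fastforce
      then show "pairing (x, x') (y, v) - s \<le> q_L (y, v)"
        using q by simp
    qed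
    ultimately have "(y, y' - v) \<in> coinc (at_conjugate f)" "(y, v) \<in> coinc (at_conjugate g)"
      using coincI f_conj_ge g_conj_ge by blast+
    moreover have "(y' - v) + v = y'" by simp
    ultimately show "\<exists>u v. (y, u) \<in> coinc (at_conjugate f) \<and> (y, v) \<in> coinc (at_conjugate g) \<and> u + v = y'"
      by blast
  next
    assume "\<exists>u v. (y, u) \<in> coinc (at_conjugate f) \<and> (y, v) \<in> coinc (at_conjugate g) \<and> u + v = y'"
    then obtain u v where u: "at_conjugate f (y, u) \<le> ereal (q_L (y, u))"
      and v: "at_conjugate g (y, v) \<le> ereal (q_L (y, v))" and y': "y' = u + v"
      using coincD by blast
    have "at_conjugate ?h (y, y') \<le> ereal (q_L (y, y'))"
      unfolding h_conj_le
    proof (intro ballI, clarify)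
      fix x x' r assume "((x, x'), r) \<in> fibre_sum ?A ?B"
      then obtain \<xi> \<eta> s t where mem: "((x, \<xi>), s) \<in> ?A" "((x, \<eta>), t) \<in> ?B"
        and eq: "x' = \<xi> + \<eta>" "r = s + t"
        by (auto simp: fibre_sum_def)
      have "pairing (x, \<xi>) (y, u) - s \<le> q_L (y, u)" "pairing (x, \<eta>) (y, v) - t \<le> q_L (y, v)"
        using u v mem unfolding conj_le by blast+
      then show "pairing (x, x') (y, y') - r \<le> q_L (y, y')"
        by (simp add: eq y' pairing_def q_L_def blinfun.add_left)
    qed
    then show "(y, y') \<in> coinc (at_conjugate ?h)"
      using coincI h(1) by blast
  qed
  then show ?thesis
    using h by blast
qed

end
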